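(* Let $B$ be a Blaschke product with zeros $a_k$, and suppose $A(\mathbb{D})_B\neq\mathbb{C}$ (i.e. $A(\mathbb{D})_B$ does not consist only of constants). Then the maximal ideal space $M$ of $A(\mathbb{D})_B$ is exactly the set of multiplicative linear functionals $f\mapsto f(\lambda)$ with $\lambda\in\overline{\mathbb{D}}$ (evaluations at points of $\overline{\mathbb{D}}$). Moreover, via $\lambda\mapsto(f\mapsto f(\lambda))$, $M$ can be identified (homeomorphically) with the quotient space $\overline{\mathbb{D}}/{\sim}$, where $z\sim w$ if and only if $z=w$ or $z,w\in\overline{\{a_k\}_{k}}$ (the closure being taken in $\overline{\mathbb{D}}$).
   Context: $\mathbb{D}=\{z\in\mathbb{C}:|z|<1\}$; $A(\mathbb{D})$ is the disk algebra, i.e. the algebra of bounded holomorphic functions on $\mathbb{D}$ having a continuous extension to $\overline{\mathbb{D}}$, with pointwise operations and the supremum norm. A Blaschke product $B$ with (finitely or infinitely many) distinct zeros $a_k\in\mathbb{D}$, $k\ge1$, of multiplicity $m_k\geq 1$ is $B=\prod_{k\ge1}\left(\frac{|a_k|}{a_k}\varphi_{a_k}\right)^{m_k}$, where $\varphi_a(z)=\frac{a-z}{1-\overline{a}z}$, $\sum_{k\ge1}m_k(1-|a_k|)<\infty$, and the factor $\frac{|a_k|}{a_k}$ is interpreted as $-1$ if $a_k=0$. $A(\mathbb{D})_B$ is the set of all $f\in A(\mathbb{D})$ such that $f(a_j)=f(a_k)$ for all $j,k$, and $f^{(m)}(a_k)=0$ for all $k$ and all $1\le m\le m_k-1$. It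 is a unital Banach algebra with the supremum norm; its maximal ideal space is the set of non-zero multiplicative linear functionals on it, with the Gelfand (weak-$*$) topology. *)

theory Defs
  imports "HOL-Analysis.Analysis" "HOL-Library.Extended_Nat"
begin

definition disk_involution :: "complex \<Rightarrow> complex \<Rightarrow> complex" where
  "disk_involution a z = (a - z) / (1 - cnj a * z)"

definition blaschke_factor :: "complex \<Rightarrow> complex \<Rightarrow> complex" where
  "blaschke_factor a z =
     (if a = 0 then -1 else of_real (norm a) / a) * disk_involution a z"

text \<open>The zeros are numbered \<open>a 1, a 2, \<dots>\<close>, with \<open>N\<close> zeros in all, where \<open>N = \<infinity>\<close> is allowed;
  \<open>N = 0\<close> gives the empty product.\<close>

definition zero_index :: "enat \<Rightarrow> nat set" where
  "zero_index N = {k. 1 \<le> k \<and> enat k \<le> N}"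

definition is_blaschke_product ::
    "(complex \<Rightarrow> complex) \<Rightarrow> enat \<Rightarrow> (nat \<Rightarrow> complex) \<Rightarrow> (nat \<Rightarrow> nat) \<Rightarrow> bool" where
  "is_blaschke_product B N a m \<longleftrightarrow>
     inj_on a (zero_index N) \<and>
     (\<forall>k\<in>zero_index N. norm (a k) < 1 \<and> 1 \<le> m k) \<and>
     (\<lambda>k. real (m k) * (1 - norm (a k))) summable_on zero_index N \<and>
     (\<forall>z\<in>ball 0 1. B z = (\<Prod>k. if k \<in> zero_index N then blaschke_factor (a k) z ^ m k else 1))"

text \<open>An element of the disk algebra is represented by its unique continuous extension to the closed
  disk, set to \<open>0\<close> outside. Thus equality of elements is equality of functions, and the pointwise
  operations on functions are the operations of the algebra.\<close>

definition disk_algebra :: "(complex \<Rightarrow> complex) set" where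
  "disk_algebra = {f. f holomorphic_on ball 0 1 \<and> continuous_on (cball 0 1) f \<and>
                      (\<forall>z. z \<notin> cball 0 1 \<longrightarrow> f z = 0)}"

definition disk_constants :: "(complex \<Rightarrow> complex) set" where
  "disk_constants = range (\<lambda>c z. if z \<in> cball 0 1 then c else 0)"

definition disk_algebra_B ::
    "enat \<Rightarrow> (nat \<Rightarrow> complex) \<Rightarrow> (nat \<Rightarrow> nat) \<Rightarrow> (complex \<Rightarrow> complex) set" where
  "disk_algebra_B N a m = {f \<in> disk_algebra.
     (\<forall>j\<in>zero_index N. \<forall>k\<in>zero_index N. f (a j) = f (a k)) \<and>
     (\<forall>k\<in>zero_index N. \<forall>n. 1 \<le> n \<and> n \<le> m k - 1 \<longrightarrow> (deriv ^^ n) f (a k) = 0)}"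

lemma disk_algebra_mult:
  "f \<in> disk_algebra \<Longrightarrow> g \<in> disk_algebra \<Longrightarrow> (\<lambda>z. f z * g z) \<in> disk_algebra"
  by (auto simp: disk_algebra_def intro: holomorphic_on_mult continuous_on_mult)

text \<open>A functional on \<open>A\<close> is a function that is \<open>undefined\<close> outside \<open>A\<close>, so that functionals are
  equal as soon as they agree on \<open>A\<close>.\<close>

definition characters :: "('a \<Rightarrow> complex) set \<Rightarrow> (('a \<Rightarrow> complex) \<Rightarrow> complex) set" where
  "characters A = {\<phi> \<in> extensional A.
     (\<forall>f\<in>A. \<forall>g\<in>A. \<phi> (\<lambda>x. f x + g x) = \<phi> f + \<phi> g) \<and>
     (\<forall>c. \<forall>f\<in>A. \<phi> (\<lambda>x. c * f x) = c * \<phi> f) \<and>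
     (\<forall>f\<in>A. \<forall>g\<in>A. \<phi> (\<lambda>x. f x * g x) = \<phi> f * \<phi> g) \<and>
     (\<exists>f\<in>A. \<phi> f \<noteq> 0)}"

text \<open>The weak-* topology is the topology of pointwise convergence on \<open>A\<close>.\<close>

definition maximal_ideal_space :: "('a \<Rightarrow> complex) set \<Rightarrow> (('a \<Rightarrow> complex) \<Rightarrow> complex) topology" where
  "maximal_ideal_space A = subtopology (product_topology (\<lambda>_. euclidean) A) (characters A)"

lemma topspace_maximal_ideal_space [simp]: "topspace (maximal_ideal_space A) = characters A"
  by (auto simp: maximal_ideal_space_def characters_def PiE_def)

definition point_eval :: "('a \<Rightarrow> complex) set \<Rightarrow> 'a \<Rightarrow> ('a \<Rightarrow> complex) \<Rightarrow> complex" where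
  "point_eval A z = (\<lambda>f\<in>A. f z)"

definition quotient_topology :: "'a topology \<Rightarrow> 'a rel \<Rightarrow> 'a set topology" where
  "quotient_topology X R = topology (\<lambda>U. U \<subseteq> topspace X // R \<and> openin X (\<Union>U))"

lemma openin_quotient_topology:
  assumes R: "equiv (topspace X) R"
  shows "openin (quotient_topology X R) U \<longleftrightarrow> U \<subseteq> topspace X // R \<and> openin X (\<Union>U)"
proof -
  have "\<Union>(S \<inter> T) = \<Union>S \<inter> \<Union>T" if "S \<subseteq> topspace X // R" "T \<subseteq> topspace X // R" for S T
    using quotient_disj[OF R] that by blast
  moreover have "\<Union>(\<Union>K) = \<Union>(Union ` K)" for K :: "'a set set set"
    by blast
  ultimately have "istopology (\<lambda>U. U \<subseteq> topspace X // R \<and> openin X (\<Union>U))"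
    unfolding istopology_def by (auto simp: Sup_le_iff)
  then show ?thesis
    by (simp add: quotient_topology_def)
qed

lemma quotient_map_quotient_topology:
  assumes R: "equiv (topspace X) R"
  shows "quotient_map X (quotient_topology X R) (\<lambda>x. R `` {x})"
proof -
  have U: "\<Union>(topspace X // R) = topspace X"
    by (rule Union_quotient[OF R])
  have "topspace (quotient_topology X R) = topspace X // R"
    unfolding topspace_def[of "quotient_topology X R"] openin_quotient_topology[OF R]
    using U by (auto simp: openin_topspace)
  moreover have "{x \<in> topspace X. R `` {x} \<in> V} = \<Union>V" if "V \<subseteq> topspace X // R" for V
  proof (intro subset_antisym subsetI)
    fix x assume "x \<in> {x \<in> topspace X. R `` {x} \<in> V}"
    then show "x \<in> \<Union>V" using equiv_class_self[OF R] by blast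
  next
    fix x assume "x \<in> \<Union>V"
    then obtain C where C: "C \<in> V" "x \<in> C" by blast
    with that have CQ: "C \<in> topspace X // R" by blast
    then have x: "x \<in> topspace X" using U C by blast
    have "R `` {x} = C"
      using quotient_eqI[OF R quotientI[OF x] CQ, of x x] equiv_class_self[OF R x] C R x
      by (auto simp: equiv_def refl_on_def)
    with C x show "x \<in> {x \<in> topspace X. R `` {x} \<in> V}" by simp
  qed
  ultimately show ?thesis
    by (auto simp: quotient_map_def openin_quotient_topology[OF R] quotient_def)
qed

definition closed_disk_rel :: "complex set \<Rightarrow> complex rel" where
  "closed_disk_rel S = {(z, w). z \<in> cball 0 1 \<and> w \<in> cball 0 1 \<and>
     (z = w \<or> z \<in> top_of_set (cball 0 1) closure_of S \<and> w \<in> top_of_set (cball 0 1) closure_of S)}"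

lemma equiv_closed_disk_rel: "equiv (cball 0 1) (closed_disk_rel S)"
  by (auto simp: closed_disk_rel_def equiv_def refl_on_def sym_def trans_def)

end

theory Submission
  imports Defs "HOL-Complex_Analysis.Complex_Analysis"
begin

text \<open>Write \<open>A\<close> for the algebra, \<open>E\<close> for the set of zeros and \<open>J\<close> for the functions of the disk
  algebra that vanish at every zero to its prescribed order. Then \<open>A = J + \<complex>\<close>, and \<open>J\<close> is an ideal
  not only of \<open>A\<close> but of the whole disk algebra.

  Every character is an evaluation. A character \<open>\<phi>\<close> that vanishes on \<open>J\<close> reads off the constant part,
  which is the value at any zero. Otherwise pick \<open>g \<in> J\<close> with \<open>\<phi> g \<noteq> 0\<close>: since \<open>f g \<in> A\<close> for every \<open>f\<close> in
  the disk algebra, \<open>f \<mapsto> \<phi> (f g) / \<phi> g\<close> extends \<open>\<phi>\<close> to a character of the disk algebra, and those are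
  evaluations (\<open>disk_algebra_character_is_eval\<close>).

  Evaluations at \<open>z\<close> and \<open>w\<close> agree only if \<open>z \<sim> w\<close>. Here the point is an element \<open>h\<close> of \<open>J\<close> without
  zeros outside the closure of \<open>E\<close> (\<open>zero_data_function\<close>): if \<open>z\<close> is outside that closure, the function
  \<open>x \<mapsto> (x - w) h x\<close> lies in \<open>A\<close> and separates \<open>z\<close> from \<open>w\<close>. The function \<open>h\<close> is the Blaschke product times
  a function \<open>p\<close> of the disk algebra whose zero set is exactly the part \<open>K\<close> of the closure of \<open>E\<close> on the
  circle, the only place where the Blaschke product may fail to be continuous. Such a \<open>p\<close> exists by a
  construction of Fatou (\<open>Fatou_vanishing_function\<close>) once \<open>K\<close> has length zero. This is where the
  existence of a nonconstant element of \<open>A\<close> enters: minus its value on \<open>E\<close>, it is a nonzero function of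
  the disk algebra that vanishes on \<open>K\<close>, and the boundary zeros of such a function have length zero
  (\<open>boundary_zeros_length_zero\<close>).

  Finally, \<open>\<lambda> \<mapsto>\<close> evaluation at \<open>\<lambda>\<close> is a continuous surjection from a compact space onto a Hausdorff space,
  hence a quotient map, and it induces a homeomorphism from the quotient by its fibres.\<close>

section \<open>Characters of the disk algebra\<close>

text \<open>The normal form of the elements of \<^const>\<open>disk_algebra\<close>, which are \<open>0\<close> off the closed disk. The
  unit of the algebra is therefore \<open>on_disk (\<lambda>_. 1)\<close>, not the constant function.\<close>

definition on_disk :: "(complex \<Rightarrow> complex) \<Rightarrow> complex \<Rightarrow> complex" where
  "on_disk f z = (if z \<in> cball 0 1 then f z else 0)"

lemma on_disk_in_disk_algebra:
  assumes "f holomorphic_on ball 0 1" "continuous_on (cball 0 1) f"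
  shows "on_disk f \<in> disk_algebra"
proof -
  have "on_disk f holomorphic_on ball 0 1"
    by (rule holomorphic_transform[OF assms(1)]) (auto simp: on_disk_def)
  moreover have "continuous_on (cball 0 1) (on_disk f)"
    using assms(2) by (rule continuous_on_eq) (auto simp: on_disk_def)
  ultimately show ?thesis
    by (auto simp: disk_algebra_def on_disk_def)
qed

lemma disk_algebra_add:
  "f \<in> disk_algebra \<Longrightarrow> g \<in> disk_algebra \<Longrightarrow> (\<lambda>z. f z + g z) \<in> disk_algebra"
  by (auto simp: disk_algebra_def intro: holomorphic_on_add continuous_on_add)

lemma disk_algebra_cmult: "f \<in> disk_algebra \<Longrightarrow> (\<lambda>z. c * f z) \<in> disk_algebra"
  by (auto simp: disk_algebra_def intro!: holomorphic_intros continuous_intros)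

lemma on_disk_1_in_disk_algebra: "on_disk (\<lambda>_. 1) \<in> disk_algebra"
  by (rule on_disk_in_disk_algebra) auto

lemma character_add:
  "\<phi> \<in> characters A \<Longrightarrow> f \<in> A \<Longrightarrow> g \<in> A \<Longrightarrow> \<phi> (\<lambda>x. f x + g x) = \<phi> f + \<phi> g"
  and character_cmult: "\<phi> \<in> characters A \<Longrightarrow> f \<in> A \<Longrightarrow> \<phi> (\<lambda>x. c * f x) = c * \<phi> f"
  and character_mult:
  "\<phi> \<in> characters A \<Longrightarrow> f \<in> A \<Longrightarrow> g \<in> A \<Longrightarrow> \<phi> (\<lambda>x. f x * g x) = \<phi> f * \<phi> g"
  by (auto simp: characters_def)

lemma character_unit:
  assumes "\<phi> \<in> characters A" "u \<in> A" "\<And>f. f \<in> A \<Longrightarrow> (\<lambda>x. u x * f x) = f"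
  shows "\<phi> u = 1"
proof -
  obtain f where "f \<in> A" "\<phi> f \<noteq> 0"
    using assms(1) by (auto simp: characters_def)
  then show ?thesis
    using character_mult[OF assms(1,2), of f] assms(3)[of f] by simp
qed

lemma on_disk_1_mult: "f \<in> disk_algebra \<Longrightarrow> (\<lambda>x. on_disk (\<lambda>_. 1) x * f x) = f"
  by (rule ext) (auto simp: on_disk_def disk_algebra_def)

lemma disk_algebra_character_unit:
  "\<phi> \<in> characters disk_algebra \<Longrightarrow> \<phi> (on_disk (\<lambda>_. 1)) = 1"
  using character_unit on_disk_1_in_disk_algebra on_disk_1_mult by blast

lemma disk_algebra_diff:
  "f \<in> disk_algebra \<Longrightarrow> g \<in> disk_algebra \<Longrightarrow> (\<lambda>z. f z - g z) \<in> disk_algebra"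
  by (auto simp: disk_algebra_def intro: holomorphic_on_diff continuous_on_diff)

lemma disk_algebra_character_diff:
  assumes "\<phi> \<in> characters disk_algebra" "f \<in> disk_algebra" "g \<in> disk_algebra"
  shows "\<phi> (\<lambda>z. f z - g z) = \<phi> f - \<phi> g"
  using character_add[OF assms(1) disk_algebra_diff[OF assms(2,3)] assms(3)] by simp

lemma disk_algebra_character_const:
  "\<phi> \<in> characters disk_algebra \<Longrightarrow> \<phi> (\<lambda>z. c * on_disk (\<lambda>_. 1) z) = c"
  by (simp add: character_cmult[OF _ on_disk_1_in_disk_algebra] disk_algebra_character_unit)

lemma disk_algebra_const: "(\<lambda>z. c * on_disk (\<lambda>_. 1) z) \<in> disk_algebra"
  by (intro disk_algebra_cmult on_disk_1_in_disk_algebra)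

text \<open>Otherwise \<open>f - \<phi> f\<close> has no zero on the closed disk, hence is invertible in the algebra, although
  \<open>\<phi>\<close> maps it to \<open>0\<close>. Besides placing \<open>\<phi> (on_disk (\<lambda>z. z))\<close> in the closed disk, this gives the
  continuity of characters: \<open>\<bar>\<phi> f\<bar>\<close> is at most the supremum of \<open>\<bar>f\<bar>\<close>.\<close>

lemma disk_algebra_character_in_range:
  assumes \<phi>: "\<phi> \<in> characters disk_algebra" and f: "f \<in> disk_algebra"
  shows "\<exists>z\<in>cball 0 1. \<phi> f = f z"
proof (rule ccontr)
  assume no: "\<not> (\<exists>z\<in>cball 0 1. \<phi> f = f z)"
  let ?u = "on_disk (\<lambda>_. 1)"
  define g where "g = (\<lambda>z. f z - \<phi> f * ?u z)"
  have g: "g \<in> disk_algebra"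
    unfolding g_def by (intro disk_algebra_diff disk_algebra_const f)
  have \<phi>g: "\<phi> g = 0"
    unfolding g_def
    by (simp add: disk_algebra_character_diff[OF \<phi> f disk_algebra_const]
        disk_algebra_character_const[OF \<phi>])
  have nz: "g z \<noteq> 0" if "z \<in> cball 0 1" for z
  proof -
    have "\<phi> f \<noteq> f z" using no that by blast
    then show ?thesis using that by (auto simp: g_def on_disk_def)
  qed
  let ?h = "on_disk (\<lambda>z. 1 / g z)"
  have h: "?h \<in> disk_algebra"
    using g nz by (intro on_disk_in_disk_algebra)
      (auto simp: disk_algebra_def intro!: holomorphic_intros continuous_intros)
  have "(\<lambda>z. g z * ?h z) = ?u"
    using nz by (auto simp: on_disk_def fun_eq_iff)
  then have "\<phi> ?u = \<phi> g * \<phi> ?h"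
    using character_mult[OF \<phi> g h] by simp
  then show False
    using disk_algebra_character_unit[OF \<phi>] \<phi>g by simp
qed

text \<open>If \<open>F\<close> extends beyond the closed disk, the quotient \<open>(F - F l) / (z - l)\<close> stays in the disk algebra
  even when \<open>l\<close> is on the circle, so \<open>F - F l\<close> is a multiple of \<open>z - l\<close>, which \<open>\<phi>\<close> annihilates.\<close>

lemma disk_algebra_character_eval_extendable:
  assumes \<phi>: "\<phi> \<in> characters disk_algebra" and l: "\<phi> (on_disk (\<lambda>z. z)) = l" "l \<in> cball 0 1"
    and F: "F holomorphic_on ball 0 R" and R: "R > 1"
  shows "\<phi> (on_disk F) = F l"
proof -
  define H where "H = (\<lambda>z. if z = l then deriv F l else (F z - F l) / (z - l))"
  have H: "H holomorphic_on ball 0 R"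
    unfolding H_def by (rule pole_lemma_open[OF F]) simp
  have sub: "ball 0 1 \<subseteq> ball (0::complex) R" "cball 0 1 \<subseteq> ball (0::complex) R"
    using R by auto
  have inA: "on_disk G \<in> disk_algebra" if "G holomorphic_on ball 0 R" for G
    using that sub by (meson holomorphic_on_imp_continuous_on holomorphic_on_subset on_disk_in_disk_algebra)
  let ?u = "on_disk (\<lambda>_. 1)"
  let ?d = "\<lambda>z. on_disk (\<lambda>z. z) z - l * ?u z"
  have X: "on_disk (\<lambda>z. z) \<in> disk_algebra" by (rule inA) auto
  have d: "?d \<in> disk_algebra"
    by (intro disk_algebra_diff disk_algebra_const X)
  have "\<phi> ?d = 0"
    by (simp only: disk_algebra_character_diff[OF \<phi> X disk_algebra_const]
        disk_algebra_character_const[OF \<phi>] l) simp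
  then have 0: "\<phi> (\<lambda>z. ?d z * on_disk H z) = 0"
    using character_mult[OF \<phi> d inA[OF H]] by simp
  have "on_disk F = (\<lambda>z. ?d z * on_disk H z + F l * ?u z)"
    by (auto simp: on_disk_def H_def fun_eq_iff)
  then have "\<phi> (on_disk F) = \<phi> (\<lambda>z. ?d z * on_disk H z) + \<phi> (\<lambda>z. F l * ?u z)"
    using character_add[OF \<phi> disk_algebra_mult[OF d inA[OF H]]
        disk_algebra_const[of "F l"]] by simp
  then show ?thesis
    using 0 disk_algebra_character_const[OF \<phi>] by simp
qed

lemma dilation_uniformly_close:
  fixes f :: "complex \<Rightarrow> complex"
  assumes "continuous_on (cball 0 1) f" "\<epsilon> > 0"
  obtains r where "0 < r" "r < 1" "\<And>z. z \<in> cball 0 1 \<Longrightarrow> norm (f (of_real r * z) - f z) < \<epsilon>"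
proof -
  have "uniformly_continuous_on (cball 0 1) f"
    using assms by (simp add: compact_uniformly_continuous)
  then obtain d where d: "d > 0"
    "\<And>x y. \<lbrakk>x \<in> cball 0 1; y \<in> cball 0 1; dist y x < d\<rbrakk> \<Longrightarrow> dist (f y) (f x) < \<epsilon>"
    unfolding uniformly_continuous_on_def using \<open>\<epsilon> > 0\<close> by metis
  define r where "r = max (1/2) (1 - d/2)"
  have r: "0 < r" "r < 1" "1 - r < d"
    using d(1) by (auto simp: r_def)
  show thesis
  proof (rule that[OF r(1,2)])
    fix z :: complex assume z: "z \<in> cball 0 1"
    have "norm (of_real r * z) \<le> 1 * 1"
      unfolding norm_mult using r z by (intro mult_mono) auto
    moreover have "of_real r * z - z = - (of_real (1 - r) * z)"
      by (simp add: algebra_simps)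
    then have "norm (of_real r * z - z) = (1 - r) * norm z"
      using r by (simp only: norm_minus_cancel norm_mult norm_of_real)
    then have "dist (of_real r * z) z \<le> (1 - r) * 1"
      unfolding dist_norm using r z by (metis diff_ge_0_iff_ge less_imp_le mem_cball_0 mult_left_mono)
    ultimately show "norm (f (of_real r * z) - f z) < \<epsilon>"
      using d(2)[of z "of_real r * z"] z r by (auto simp: dist_norm)
  qed
qed

text \<open>The dilations \<open>z \<mapsto> f (r z)\<close> with \<open>r < 1\<close> extend beyond the closed disk and converge to \<open>f\<close>
  uniformly as \<open>r\<close> tends to \<open>1\<close>, so continuity of the character reduces the claim to the previous
  lemma.\<close>

lemma disk_algebra_character_is_eval:
  assumes \<phi>: "\<phi> \<in> characters disk_algebra"
  obtains l where "l \<in> cball 0 1" "\<And>f. f \<in> disk_algebra \<Longrightarrow> \<phi> f = f l"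
proof -
  define l where "l = \<phi> (on_disk (\<lambda>z. z))"
  have "on_disk (\<lambda>z. z) \<in> disk_algebra"
    by (rule on_disk_in_disk_algebra) (auto intro: continuous_intros)
  then have l: "l \<in> cball 0 1"
    using disk_algebra_character_in_range[OF \<phi>] unfolding l_def by (fastforce simp: on_disk_def)
  show thesis
  proof (rule that[OF l])
    fix f assume f: "f \<in> disk_algebra"
    have "norm (\<phi> f - f l) \<le> \<epsilon>" if "\<epsilon> > 0" for \<epsilon>
    proof -
      have f': "f holomorphic_on ball 0 1" "continuous_on (cball 0 1) f"
        using f by (auto simp: disk_algebra_def)
      obtain r where r: "0 < r" "r < 1"
        "\<And>z. z \<in> cball 0 1 \<Longrightarrow> norm (f (of_real r * z) - f z) < \<epsilon>/2"
        using dilation_uniformly_close[OF f'(2), of "\<epsilon>/2"] \<open>\<epsilon> > 0\<close> by auto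
      define F where "F = (\<lambda>z. f (of_real r * z))"
      have "(f \<circ> (\<lambda>z. of_real r * z)) holomorphic_on ball 0 (1/r)"
        by (rule holomorphic_on_compose_gen[OF _ f'(1)])
           (use r in \<open>auto simp: norm_mult field_simps intro!: holomorphic_intros\<close>)
      then have F: "F holomorphic_on ball 0 (1/r)"
        by (simp add: F_def o_def)
      have \<phi>F: "\<phi> (on_disk F) = F l"
        by (rule disk_algebra_character_eval_extendable[OF \<phi> l_def[symmetric] l F]) (use r in auto)
      have FA: "on_disk F \<in> disk_algebra"
      proof (rule on_disk_in_disk_algebra)
        have "1 < 1/r" using r by simp
        then have "ball 0 1 \<subseteq> ball (0::complex) (1/r)" "cball 0 1 \<subseteq> ball (0::complex) (1/r)"
          by auto
        then show "F holomorphic_on ball 0 1" "continuous_on (cball 0 1) F"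
          using F by (meson holomorphic_on_imp_continuous_on holomorphic_on_subset)+
      qed
      define g where "g = (\<lambda>z. f z - on_disk F z)"
      have g: "g \<in> disk_algebra"
        unfolding g_def by (intro disk_algebra_diff f FA)
      have "\<phi> g = \<phi> f - F l"
        unfolding g_def using disk_algebra_character_diff[OF \<phi> f FA] \<phi>F by simp
      moreover obtain z where "z \<in> cball 0 1" "\<phi> g = g z"
        using disk_algebra_character_in_range[OF \<phi> g] by blast
      ultimately have "norm (\<phi> f - F l) < \<epsilon>/2"
        using r(3)[of z] by (simp add: g_def on_disk_def F_def norm_minus_commute)
      moreover have "norm (F l - f l) < \<epsilon>/2"
        using r(3)[OF l] by (simp add: F_def)
      ultimately show ?thesis
        using norm_triangle_ineq[of "\<phi> f - F l" "F l - f l"] by simp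
    qed
    then show "\<phi> f = f l"
      by (metis field_le_epsilon add_0 norm_le_zero_iff right_minus_eq)
  qed
qed

section \<open>Boundary zeros have length zero\<close>

text \<open>Such a circle replaces the origin, where \<open>f\<close> may vanish, in the comparison with the boundary below.\<close>

lemma nonvanishing_circle:
  assumes f: "f holomorphic_on ball 0 1" and b: "\<beta> \<in> ball 0 1" "f \<beta> \<noteq> 0"
  obtains s where "0 < s" "s < 1" "\<And>z. z \<in> sphere 0 s \<Longrightarrow> f z \<noteq> 0"
proof -
  obtain r where r: "0 < r" "\<And>z. \<lbrakk>z \<in> ball 0 r; z \<noteq> 0\<rbrakk> \<Longrightarrow> f z \<noteq> 0"
  proof (cases "f 0 = 0")
    case True
    show thesis
      by (rule isolated_zeros[OF f open_ball connected_ball _ True b]) (auto intro: that)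
  next
    case False
    have "isCont f 0"
      using holomorphic_on_imp_continuous_on[OF f] by (simp add: continuous_on_eq_continuous_at)
    then obtain r where "0 < r" "\<And>z. dist 0 z < r \<Longrightarrow> f z \<noteq> 0"
      using continuous_at_avoid[of 0 f 0] False by auto
    then show thesis by (intro that) auto
  qed
  show thesis
  proof (rule that[of "min r 1 / 2"])
    fix z :: complex assume "z \<in> sphere 0 (min r 1 / 2)"
    then have "norm z = min r 1 / 2" by simp
    with r(1) show "f z \<noteq> 0" by (intro r(2)) auto
  qed (use r(1) in auto)
qed

lemma norm_cis_diff_le: "norm (cis x - cis y) \<le> \<bar>x - y\<bar>"
proof -
  have "norm (cis x - cis y) = norm (cis y * (cis (x - y) - 1))"
    by (simp add: right_diff_distrib cis_mult)
  also have "\<dots> = 2 * \<bar>sin ((x - y) / 2)\<bar>"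
    using dist_exp_i_1[of "x - y"] by (simp add: norm_mult cis_conv_exp)
  also have "\<dots> \<le> 2 * \<bar>(x - y) / 2\<bar>"
    by (intro mult_left_mono abs_sin_x_le_abs_x) auto
  finally show ?thesis by simp
qed

text \<open>The angular distance is below \<open>2 \<pi> / n\<close>; the constant 7 is a convenient bound for \<open>2 \<pi>\<close>.\<close>

lemma rotations_dense:
  assumes "w \<in> sphere 0 1" "z \<in> sphere 0 1" "n > 0"
  shows "\<exists>j<n. norm (w - cis (2 * pi * real j / real n) * z) < 7 / real n"
proof -
  have z0: "z \<noteq> 0" "norm z = 1" "norm w = 1" using assms by auto
  define \<theta> where "\<theta> = Arg2pi (w / z)"
  have \<theta>: "0 \<le> \<theta>" "\<theta> < 2 * pi"
    by (auto simp: \<theta>_def Arg2pi_ge_0 Arg2pi_lt_2pi)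
  have "w / z = cis \<theta>"
    using Arg2pi_eq[of "w / z"] z0 by (simp add: \<theta>_def norm_divide cis_conv_exp)
  then have w: "w = cis \<theta> * z" using z0 by (simp add: field_simps)
  define x where "x = \<theta> * real n / (2 * pi)"
  have x: "0 \<le> x" "x < real n"
    using \<theta> \<open>n > 0\<close> by (auto simp: x_def field_simps)
  define j where "j = nat \<lfloor>x\<rfloor>"
  have j: "real j \<le> x" "x < real j + 1"
    using x(1) by (auto simp: j_def)
  have "\<theta> - 2 * pi * real j / real n = (x - real j) * (2 * pi / real n)"
    using \<open>n > 0\<close> by (simp add: x_def field_simps)
  then have "\<bar>\<theta> - 2 * pi * real j / real n\<bar> = (x - real j) * (2 * pi / real n)"
    using j by simp
  also have "\<dots> \<le> 1 * (2 * pi / real n)"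
    using j by (intro mult_right_mono) auto
  also have "\<dots> < 7 / real n"
    using pi_less_4 pi_approx \<open>n > 0\<close> by (simp add: divide_strict_right_mono)
  finally have "norm (cis \<theta> - cis (2 * pi * real j / real n)) < 7 / real n"
    using norm_cis_diff_le order_le_less_trans by blast
  moreover have "w - cis (2 * pi * real j / real n) * z = (cis \<theta> - cis (2 * pi * real j / real n)) * z"
    by (simp add: w algebra_simps)
  ultimately have "norm (w - cis (2 * pi * real j / real n) * z) < 7 / real n"
    using z0 by (simp add: norm_mult)
  moreover have "j < n" using j x by linarith
  ultimately show ?thesis by blast
qed

text \<open>The maximum principle for \<open>\<Prod>j f (u j z)\<close>. Multiplying rotated copies of \<open>f\<close> turns a lower bound on one
  circle into a lower bound for a geometric mean over points of the unit circle: a discrete substitute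
  for Jensen's inequality.\<close>

lemma rotation_product_large:
  assumes f: "f holomorphic_on ball 0 1" "continuous_on (cball 0 1) f"
    and s: "0 < s" "s < 1" and \<kappa>: "0 \<le> \<kappa>" "\<And>z. z \<in> sphere 0 s \<Longrightarrow> \<kappa> \<le> norm (f z)"
    and u: "\<And>j. j < n \<Longrightarrow> norm (u j) = 1"
  shows "\<exists>z\<in>sphere 0 1. \<kappa> ^ n \<le> (\<Prod>j<n. norm (f (u j * z)))"
proof -
  define G where "G = (\<lambda>z. \<Prod>j<n. f (u j * z))"
  have "(f \<circ> (\<lambda>z. u j * z)) holomorphic_on ball 0 1" if "j < n" for j
    by (rule holomorphic_on_compose_gen[OF _ f(1)])
       (use u[OF that] in \<open>auto simp: norm_mult intro!: holomorphic_intros\<close>)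
  then have hol: "G holomorphic_on ball 0 1"
    unfolding G_def o_def by (intro holomorphic_on_prod) auto
  have "continuous_on (cball 0 1) (f \<circ> (\<lambda>z. u j * z))" if "j < n" for j
    by (intro continuous_on_compose continuous_on_subset[OF f(2)])
       (use u[OF that] in \<open>auto simp: norm_mult intro!: continuous_intros\<close>)
  then have cont: "continuous_on (cball 0 1) G"
    unfolding G_def o_def by (intro continuous_on_prod) auto
  have "continuous_on (sphere 0 1) (\<lambda>z. norm (G z))"
    by (intro continuous_intros continuous_on_subset[OF cont]) auto
  then obtain z where z: "z \<in> sphere 0 1" "\<And>w. w \<in> sphere 0 1 \<Longrightarrow> norm (G w) \<le> norm (G z)"
    using continuous_attains_sup[of "sphere 0 1" "\<lambda>z. norm (G z)"] by auto
  have "norm (G (of_real s)) \<le> norm (G z)"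
  proof (rule maximum_modulus_frontier[where S = "cball 0 1" and f = G])
    show "G holomorphic_on interior (cball 0 1)" "continuous_on (closure (cball 0 1)) G"
      using hol cont by auto
    show "norm (G w) \<le> norm (G z)" if "w \<in> frontier (cball 0 1)" for w
      using z that by simp
  qed (use s in auto)
  moreover have "\<kappa> ^ n \<le> norm (G (of_real s))"
  proof -
    have "(\<Prod>j<n. \<kappa>) \<le> (\<Prod>j<n. norm (f (u j * of_real s)))"
      using \<kappa> u s by (intro prod_mono) (auto simp: norm_mult)
    then show ?thesis by (simp add: G_def prod_norm)
  qed
  ultimately show ?thesis
    using z(1) by (intro bexI[of _ z]) (auto simp: G_def prod_norm)
qed

text \<open>Take the \<open>n\<close>-th roots of unity as rotations. Let \<open>M\<close> bound \<open>\<bar>f\<bar>\<close> and let \<open>\<kappa> < M\<close> be a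
  lower bound on a circle inside the disk. By the previous lemma some rotated set of \<open>n\<close> equally
  spaced points has geometric mean of \<open>\<bar>f\<bar>\<close> at least \<open>\<kappa>\<close>. If \<open>M \<ge> 1\<close>, at most a fraction \<open>1 / k\<close> of the points can
  have \<open>\<bar>f\<bar> < (\<kappa> / M) ^ k\<close>. For large \<open>n\<close> every zero on the circle is close to one of these few points
  by uniform continuity, and balls of radius \<open>7 / n\<close> around them cover the zeros with total radius at
  most \<open>7 / k\<close>.\<close>

lemma boundary_zeros_length_zero:
  assumes f: "f holomorphic_on ball 0 1" "continuous_on (cball 0 1) f"
    and b: "\<beta> \<in> ball 0 1" "f \<beta> \<noteq> 0" and "\<epsilon> > 0"
  obtains T \<delta> where "finite T" "T \<subseteq> sphere 0 1" "\<delta> > 0" "real (card T) * \<delta> < \<epsilon>"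
    "{z \<in> sphere 0 1. f z = 0} \<subseteq> (\<Union>t\<in>T. ball t \<delta>)"
proof -
  obtain s where s: "0 < s" "s < 1" "\<And>z. z \<in> sphere 0 s \<Longrightarrow> f z \<noteq> 0"
    using nonvanishing_circle[OF f(1) b] by blast
  have "continuous_on (sphere 0 s) (\<lambda>z. norm (f z))"
    using s by (intro continuous_intros continuous_on_subset[OF f(2)]) auto
  then obtain z1 where z1: "z1 \<in> sphere 0 s" "\<And>w. w \<in> sphere 0 s \<Longrightarrow> norm (f z1) \<le> norm (f w)"
    using continuous_attains_inf[of "sphere 0 s" "\<lambda>z. norm (f z)"] s(1) by auto
  define \<kappa> where "\<kappa> = norm (f z1)"
  have \<kappa>: "\<kappa> > 0" "\<And>w. w \<in> sphere 0 s \<Longrightarrow> \<kappa> \<le> norm (f w)"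
    using z1 s(3)[OF z1(1)] by (auto simp: \<kappa>_def)
  have "bounded (f ` cball 0 1)"
    using f(2) by (intro compact_imp_bounded compact_continuous_image) auto
  then obtain M0 where M0: "\<And>z. z \<in> cball 0 1 \<Longrightarrow> norm (f z) \<le> M0"
    unfolding bounded_iff by blast
  define M where "M = max (max 1 (2 * \<kappa>)) M0"
  have M: "M \<ge> 1" "\<kappa> < M" "\<And>z. z \<in> cball 0 1 \<Longrightarrow> norm (f z) \<le> M"
    using \<kappa>(1) M0 by (auto simp: M_def le_max_iff_disj)
  \<comment> \<open>The threshold is a power of \<open>q\<close>, so that counting the small values compares exponents of \<open>q\<close>.\<close>
  define q where "q = \<kappa> / M"
  have q: "0 < q" "q < 1" using \<kappa>(1) M by (auto simp: q_def)
  obtain k :: nat where k: "real k > 7 / \<epsilon>"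
    using reals_Archimedean2 by blast
  have kpos: "k > 0" using k \<open>\<epsilon> > 0\<close> by (cases k) (auto simp: field_simps)
  have "uniformly_continuous_on (cball 0 1) f"
    using f(2) by (simp add: compact_uniformly_continuous)
  then obtain d where d: "d > 0"
    "\<And>x y. \<lbrakk>x \<in> cball 0 1; y \<in> cball 0 1; dist y x < d\<rbrakk> \<Longrightarrow> dist (f y) (f x) < q ^ k"
    unfolding uniformly_continuous_on_def using q(1) zero_less_power by metis
  obtain n :: nat where n: "real n > 7 / d"
    using reals_Archimedean2 by blast
  have npos: "n > 0" using n d(1) by (cases n) (auto simp: field_simps)
  define u where "u = (\<lambda>j. cis (2 * pi * real j / real n))"
  obtain z where z: "z \<in> sphere 0 1" "\<kappa> ^ n \<le> (\<Prod>j<n. norm (f (u j * z)))"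
    using rotation_product_large[OF f s(1,2) less_imp_le[OF \<kappa>(1)] \<kappa>(2), of n u]
    by (auto simp: u_def)
  have uz: "u j * z \<in> sphere 0 1" "u j * z \<in> cball 0 1" for j
    using z(1) by (auto simp: u_def norm_mult)
  define J where "J = {j. j < n \<and> norm (f (u j * z)) < q ^ k}"
  have J: "finite J" "J \<subseteq> {..<n}" by (auto simp: J_def)
  have "k * card J \<le> n"
  proof -
    have "(\<Prod>j<n. norm (f (u j * z))) \<le> (\<Prod>j<n. (if j \<in> J then q ^ k else 1) * M)"
    proof (rule prod_mono, intro conjI)
      fix j assume "j \<in> {..<n}"
      show "norm (f (u j * z)) \<le> (if j \<in> J then q ^ k else 1) * M"
      proof (cases "j \<in> J")
        case True
        then have "norm (f (u j * z)) \<le> q ^ k * 1" by (simp add: J_def)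
        also have "\<dots> \<le> q ^ k * M" using q M by (intro mult_left_mono) auto
        finally show ?thesis using True by simp
      qed (use M(3)[OF uz(2)] in simp)
    qed simp
    also have "\<dots> = (\<Prod>j\<in>J. q ^ k) * M ^ n"
      using J by (simp add: prod.distrib prod.If_cases Int_absorb1 Int_absorb2)
    also have "\<dots> = q ^ (k * card J) * M ^ n"
      by (simp add: power_mult)
    finally have "\<kappa> ^ n \<le> q ^ (k * card J) * M ^ n" using z(2) by simp
    then have "q ^ n \<le> q ^ (k * card J)"
      using M by (simp add: q_def power_divide field_simps)
    then show ?thesis
      using q by (metis linorder_not_less power_strict_decreasing)
  qed
  define T where "T = (\<lambda>j. u j * z) ` J"
  have cardT: "k * card T \<le> n"
    using \<open>k * card J \<le> n\<close> card_image_le[OF J(1), of "\<lambda>j. u j * z"]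
    unfolding T_def by (meson le_trans mult_le_mono2)
  show thesis
  proof (rule that[of T "7 / real n"])
    show "finite T" "T \<subseteq> sphere 0 1" "0 < 7 / real n"
      using J uz npos by (auto simp: T_def)
    have "real k * real (card T) \<le> real n"
      using cardT by (metis of_nat_le_iff of_nat_mult)
    then have "real (card T) * (7 / real n) \<le> 7 / real k"
      using npos kpos by (simp add: field_simps)
    also have "\<dots> < \<epsilon>"
      using k kpos \<open>\<epsilon> > 0\<close> by (simp add: field_simps)
    finally show "real (card T) * (7 / real n) < \<epsilon>" .
    show "{z \<in> sphere 0 1. f z = 0} \<subseteq> (\<Union>t\<in>T. ball t (7 / real n))"
    proof
      fix w assume "w \<in> {z \<in> sphere 0 1. f z = 0}"
      then have w: "w \<in> sphere 0 1" "f w = 0" by auto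
      obtain j where j: "j < n" "norm (w - u j * z) < 7 / real n"
        using rotations_dense[OF w(1) z(1) npos] by (auto simp: u_def)
      moreover have "7 / real n < d" using n d(1) npos by (simp add: field_simps)
      ultimately have "dist (f (u j * z)) (f w) < q ^ k"
        using w(1) uz by (intro d) (auto simp: dist_norm norm_minus_commute)
      then have "u j * z \<in> T" using j w(2) by (auto simp: T_def J_def)
      then show "w \<in> (\<Union>t\<in>T. ball t (7 / real n))"
        using j(2) by (auto simp: dist_norm norm_minus_commute intro!: bexI[of _ "u j * z"])
    qed
  qed
qed

section \<open>Functions with a prescribed zero set on the circle\<close>

text \<open>Each summand has its pole at \<open>(1 + \<delta>) t\<close>, just outside the disk. Its real part is nonnegative on the
  closed disk and at least \<open>1 / 4\<close> within distance \<open>\<delta>\<close> of \<open>t\<close>, while its modulus is at most \<open>\<delta> / d\<close> at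
  distance \<open>d\<close> from \<open>t\<close>.\<close>

definition cauchy_bumps :: "complex set \<Rightarrow> real \<Rightarrow> complex \<Rightarrow> complex" where
  "cauchy_bumps T \<delta> z = (\<Sum>t\<in>T. of_real \<delta> / (1 + of_real \<delta> - cnj t * z))"

lemma norm_one_minus_cnj_mult:
  assumes "norm t = 1"
  shows "norm (1 - cnj t * z) = norm (t - z)"
proof -
  have "cnj t * t = 1" using assms by (simp add: complex_norm_square[symmetric] mult.commute)
  then have "1 - cnj t * z = cnj t * (t - z)" by (simp add: algebra_simps)
  then show ?thesis using assms by (simp add: norm_mult)
qed

lemma cauchy_bump_bounds:
  assumes "norm w \<le> 1" "\<delta> > 0"
  shows "0 < Re (1 + of_real \<delta> - w)"
    and "0 \<le> Re (of_real \<delta> / (1 + of_real \<delta> - w))"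
    and "norm (1 - w) < \<delta> \<Longrightarrow> 1/4 \<le> Re (of_real \<delta> / (1 + of_real \<delta> - w))"
    and "norm (1 - w) \<le> norm (1 + of_real \<delta> - w)"
proof -
  define u where "u = 1 + of_real \<delta> - w"
  have "Re w \<le> 1" using complex_Re_le_cmod[of w] assms by linarith
  then have Reu: "\<delta> \<le> Re u" by (simp add: u_def)
  then show "0 < Re (1 + of_real \<delta> - w)" using assms by (simp add: u_def)
  have Re_div: "Re (of_real \<delta> / u) = \<delta> * Re u / (norm u)\<^sup>2"
    by (simp add: Re_divide cmod_power2)
  show "0 \<le> Re (of_real \<delta> / (1 + of_real \<delta> - w))"
    unfolding u_def[symmetric] Re_div using Reu assms by simp
  show "norm (1 - w) \<le> norm (1 + of_real \<delta> - w)"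
    using \<open>Re w \<le> 1\<close> assms by (auto simp: cmod_def intro!: power_mono)
  show "1/4 \<le> Re (of_real \<delta> / (1 + of_real \<delta> - w))" if "norm (1 - w) < \<delta>"
  proof -
    have "u = of_real \<delta> + (1 - w)" by (simp add: u_def)
    then have "norm u \<le> 2 * \<delta>"
      using norm_triangle_ineq[of "of_real \<delta>" "1 - w"] that assms by simp
    then have "(norm u)\<^sup>2 \<le> (2 * \<delta>)\<^sup>2" by (intro power_mono) auto
    then have "1/4 * (norm u)\<^sup>2 \<le> \<delta> * \<delta>" by (simp add: power2_eq_square)
    also have "\<dots> \<le> \<delta> * Re u" using Reu assms by (intro mult_left_mono) auto
    moreover have "u \<noteq> 0" using Reu assms by auto
    ultimately show ?thesis
      unfolding u_def[symmetric] Re_div by (simp add: field_simps)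
  qed
qed

lemma cauchy_bumps_props:
  fixes \<delta> :: real
  assumes T: "finite T" "T \<subseteq> sphere 0 1" and \<delta>: "\<delta> > 0" and z: "z \<in> cball 0 1"
  shows "0 \<le> Re (cauchy_bumps T \<delta> z)"
    and "z \<in> (\<Union>t\<in>T. ball t \<delta>) \<Longrightarrow> 1/4 \<le> Re (cauchy_bumps T \<delta> z)"
    and "\<lbrakk>d > 0; \<And>t. t \<in> T \<Longrightarrow> d \<le> dist t z\<rbrakk> \<Longrightarrow> norm (cauchy_bumps T \<delta> z) \<le> real (card T) * \<delta> / d"
proof -
  have nt: "norm (cnj t * z) \<le> 1" "norm (1 - cnj t * z) = dist t z" if "t \<in> T" for t
    using that T z norm_one_minus_cnj_mult[of t z] by (auto simp: norm_mult dist_norm)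
  have b: "t \<in> T \<Longrightarrow> 0 \<le> Re (of_real \<delta> / (1 + of_real \<delta> - cnj t * z))"
    "\<lbrakk>t \<in> T; norm (1 - cnj t * z) < \<delta>\<rbrakk> \<Longrightarrow> 1/4 \<le> Re (of_real \<delta> / (1 + of_real \<delta> - cnj t * z))"
    "t \<in> T \<Longrightarrow> norm (1 - cnj t * z) \<le> norm (1 + of_real \<delta> - cnj t * z)" for t
    using cauchy_bump_bounds(2-4)[OF nt(1) \<delta>] by blast+
  have Re: "Re (cauchy_bumps T \<delta> z) = (\<Sum>t\<in>T. Re (of_real \<delta> / (1 + of_real \<delta> - cnj t * z)))"
    by (simp add: cauchy_bumps_def)
  show "0 \<le> Re (cauchy_bumps T \<delta> z)"
    unfolding Re by (intro sum_nonneg b)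
  show "1/4 \<le> Re (cauchy_bumps T \<delta> z)" if "z \<in> (\<Union>t\<in>T. ball t \<delta>)"
  proof -
    obtain t where t: "t \<in> T" "dist t z < \<delta>" using \<open>z \<in> (\<Union>t\<in>T. ball t \<delta>)\<close> by auto
    have "1/4 \<le> Re (of_real \<delta> / (1 + of_real \<delta> - cnj t * z))"
      using t nt(2) by (intro b) auto
    also have "\<dots> \<le> Re (cauchy_bumps T \<delta> z)"
      unfolding Re using T t b(1) by (intro member_le_sum) auto
    finally show ?thesis .
  qed
  show "norm (cauchy_bumps T \<delta> z) \<le> real (card T) * \<delta> / d"
    if d: "d > 0" "\<And>t. t \<in> T \<Longrightarrow> d \<le> dist t z"
  proof -
    have "norm (of_real \<delta> / (1 + of_real \<delta> - cnj t * z)) \<le> \<delta> / d" if t: "t \<in> T" for t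
    proof -
      have "d \<le> norm (1 + of_real \<delta> - cnj t * z)"
        using b(3)[OF t] nt(2)[OF t] d(2)[OF t] by simp
      then show ?thesis using d(1) \<delta> by (simp add: norm_divide frac_le)
    qed
    then have "norm (cauchy_bumps T \<delta> z) \<le> (\<Sum>t\<in>T. \<delta> / d)"
      unfolding cauchy_bumps_def by (intro sum_norm_le)
    then show ?thesis by simp
  qed
qed

lemma cauchy_bumps_continuous_holomorphic:
  assumes T: "finite T" "T \<subseteq> sphere 0 1" and \<delta>: "\<delta> > 0"
  shows "continuous_on (cball 0 1) (cauchy_bumps T \<delta>)"
    and "cauchy_bumps T \<delta> holomorphic_on ball 0 1"
proof -
  have nz: "1 + of_real \<delta> - cnj t * z \<noteq> 0" if "t \<in> T" "z \<in> cball 0 1" for t z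
  proof -
    have "norm (cnj t * z) \<le> 1" using that T by (auto simp: norm_mult)
    from cauchy_bump_bounds(1)[OF this \<delta>] show ?thesis by (metis less_irrefl zero_complex.sel(1))
  qed
  show "continuous_on (cball 0 1) (cauchy_bumps T \<delta>)"
    unfolding cauchy_bumps_def using nz by (intro continuous_intros) auto
  show "cauchy_bumps T \<delta> holomorphic_on ball 0 1"
    unfolding cauchy_bumps_def using nz by (intro holomorphic_intros) auto
qed

text \<open>Choose covers of \<open>K\<close> by balls of total radius at most \<open>2\<^sup>-\<^sup>n\<close> and let \<open>Q\<close> be the sum over \<open>n\<close> of the
  corresponding bump functions. At positive distance from \<open>K\<close> the series converges uniformly, while near
  \<open>K\<close> arbitrarily many terms have real part at least \<open>1 / 4\<close>, so the real part of \<open>Q\<close> tends to infinity.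
  As this real part is never negative, \<open>1 / (1 + Q)\<close> is the required function.\<close>

lemma Fatou_vanishing_function:
  assumes K: "closed K" "K \<subseteq> sphere 0 1"
    and cover: "\<And>\<epsilon>. \<epsilon> > 0 \<Longrightarrow> \<exists>T \<delta>. finite T \<and> T \<subseteq> sphere 0 1 \<and> \<delta> > 0 \<and>
                  real (card T) * \<delta> < \<epsilon> \<and> K \<subseteq> (\<Union>t\<in>T. ball t \<delta>)"
  obtains p where "p holomorphic_on ball 0 1" "continuous_on (cball 0 1) p"
    "\<And>z. z \<in> cball 0 1 \<Longrightarrow> p z = 0 \<longleftrightarrow> z \<in> K"
proof -
  define good where "good n T \<delta> \<longleftrightarrow> finite T \<and> T \<subseteq> sphere 0 1 \<and> \<delta> > 0 \<and>
      real (card T) * \<delta> \<le> (1/2) ^ n \<and> K \<subseteq> (\<Union>t\<in>T. ball t \<delta>) \<and>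
      (\<forall>t\<in>T. \<exists>k\<in>K. dist t k < (1/2) ^ n)" for n :: nat and T \<delta>
  have "\<exists>T \<delta>. good n T \<delta>" for n
  proof -
    obtain T0 \<delta> where T0: "finite T0" "T0 \<subseteq> sphere 0 1" "\<delta> > 0" "real (card T0) * \<delta> < (1/2) ^ n"
      "K \<subseteq> (\<Union>t\<in>T0. ball t \<delta>)"
      using cover[of "(1/2) ^ n"] by auto
    \<comment> \<open>Balls that miss \<open>K\<close> are dropped; a remaining centre is within \<open>\<delta>\<close> of \<open>K\<close>, and \<open>\<delta>\<close> is at most
      the total radius.\<close>
    define T where "T = {t \<in> T0. ball t \<delta> \<inter> K \<noteq> {}}"
    have T: "finite T" "T \<subseteq> T0" using T0(1) by (auto simp: T_def)
    have card: "real (card T) * \<delta> \<le> (1/2) ^ n"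
    proof -
      have "real (card T) * \<delta> \<le> real (card T0) * \<delta>"
        using card_mono[OF T0(1) T(2)] T0(3) by (intro mult_right_mono) auto
      with T0(4) show ?thesis by linarith
    qed
    have "\<exists>k\<in>K. dist t k < (1/2) ^ n" if t: "t \<in> T" for t
    proof -
      obtain k where k: "k \<in> K" "dist t k < \<delta>" using t by (auto simp: T_def)
      have "1 \<le> card T" using t T(1) by (metis One_nat_def Suc_leI card_gt_0_iff empty_iff)
      then have "1 * \<delta> \<le> real (card T) * \<delta>" using T0(3) by (intro mult_right_mono) auto
      with k card show ?thesis by (intro bexI[of _ k]) auto
    qed
    moreover have "K \<subseteq> (\<Union>t\<in>T. ball t \<delta>)" using T0(5) unfolding T_def by blast
    ultimately have "good n T \<delta>"
      unfolding good_def using T T0(2,3) card by auto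
    then show ?thesis by blast
  qed
  then obtain T \<delta> where good: "\<And>n. good n (T n) (\<delta> n)" by metis
  have T: "finite (T n)" "T n \<subseteq> sphere 0 1" "\<delta> n > 0"
    and card_T: "real (card (T n)) * \<delta> n \<le> (1/2) ^ n"
    and K_covered: "K \<subseteq> (\<Union>t\<in>T n. ball t (\<delta> n))"
    and T_near_K: "\<forall>t\<in>T n. \<exists>k\<in>K. dist t k < (1/2) ^ n" for n
    using good[of n] unfolding good_def by metis+
  define q where "q = (\<lambda>n. cauchy_bumps (T n) (\<delta> n))"
  define Q where "Q = (\<lambda>z. \<Sum>n. q n z)"
  \<comment> \<open>Off a neighbourhood of \<open>K\<close>, where the series for \<open>Q\<close> converges uniformly.\<close>
  define L where "L = (\<lambda>d. {z \<in> cball 0 1. \<forall>k\<in>K. d \<le> dist k z})"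
  have Re_q: "0 \<le> Re (q n z)" if "z \<in> cball 0 1" for n z
    unfolding q_def using cauchy_bumps_props(1)[OF T that] .
  have Re_q_near: "1/4 \<le> Re (q n z)" if "z \<in> cball 0 1" "z \<in> (\<Union>t\<in>T n. ball t (\<delta> n))" for n z
    unfolding q_def using cauchy_bumps_props(2)[OF T that] .
  have q_cont: "continuous_on (cball 0 1) (q n)" and q_hol: "q n holomorphic_on ball 0 1" for n
    unfolding q_def using cauchy_bumps_continuous_holomorphic[OF T] by auto
  have unif: "uniform_limit (L d) (\<lambda>n z. \<Sum>i<n. q i z) Q sequentially" if "d > 0" for d
    unfolding Q_def
  proof (rule Weierstrass_m_test_ev[where M = "\<lambda>n. (1/2) ^ n * (2 / d)"])
    have "(\<lambda>n. (1/2::real) ^ n) \<longlonglongrightarrow> 0" by (rule LIMSEQ_power_zero) auto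
    then have "eventually (\<lambda>n. (1/2::real) ^ n < d / 2) sequentially"
      using \<open>d > 0\<close> by (intro order_tendstoD(2)) auto
    then show "\<forall>\<^sub>F n in sequentially. \<forall>z\<in>L d. norm (q n z) \<le> (1/2) ^ n * (2 / d)"
    proof (rule eventually_mono)
      fix n :: nat assume elim: "(1/2::real) ^ n < d / 2"
      show "\<forall>z\<in>L d. norm (q n z) \<le> (1/2) ^ n * (2 / d)"
      proof
        fix z assume z: "z \<in> L d"
        have "d / 2 \<le> dist t z" if t: "t \<in> T n" for t
        proof -
          obtain k where k: "k \<in> K" "dist t k < (1/2) ^ n" using bspec[OF T_near_K t] by blast
          have "d \<le> dist k z" using z k(1) unfolding L_def by blast
          then show ?thesis using k(2) elim dist_triangle[of k z t] by (simp add: dist_commute)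
        qed
        then have "norm (q n z) \<le> real (card (T n)) * \<delta> n / (d / 2)"
          unfolding q_def using z \<open>d > 0\<close> by (intro cauchy_bumps_props(3) T) (auto simp: L_def)
        also have "\<dots> \<le> (1/2) ^ n / (d / 2)"
          using card_T \<open>d > 0\<close> by (intro divide_right_mono) auto
        finally show "norm (q n z) \<le> (1/2) ^ n * (2 / d)" by simp
      qed
    qed
    show "summable (\<lambda>n. (1/2) ^ n * (2 / d))" by (intro summable_mult2 summable_geometric) auto
  qed
  have sums: "(\<lambda>n. q n z) sums Q z" and off_K: "\<exists>d>0. z \<in> L d"
    if "z \<in> cball 0 1 - K" for z
  proof -
    have "open (- K)" "z \<in> - K" using K that by auto
    then obtain d where "d > 0" "ball z d \<subseteq> - K" by (meson open_contains_ball)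
    have "d \<le> dist k z" if "k \<in> K" for k
    proof (rule ccontr)
      assume "\<not> d \<le> dist k z"
      then have "k \<in> ball z d" by (simp add: dist_commute)
      with \<open>ball z d \<subseteq> - K\<close> that show False by blast
    qed
    then have d: "d > 0" "z \<in> L d"
      using that \<open>d > 0\<close> by (auto simp: L_def)
    then show "\<exists>d>0. z \<in> L d" by blast
    show "(\<lambda>n. q n z) sums Q z"
      using tendsto_uniform_limitI[OF unif[OF d(1)] d(2)] by (simp add: sums_def)
  qed
  have L_cont: "continuous_on (L d) Q" if "d > 0" for d
    by (rule uniform_limit_theorem[OF _ unif[OF that]])
       (auto simp: L_def intro!: always_eventually continuous_on_sum continuous_on_subset[OF q_cont])
  have Q_cont: "continuous (at z within cball 0 1) Q" if z: "z \<in> cball 0 1 - K" for z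
  proof -
    obtain d where d: "d > 0" "z \<in> L d" using off_K[OF z] by blast
    have "cball 0 1 \<inter> ball z (d/2) - {z} = L (d/2) \<inter> ball z (d/2) - {z}"
    proof -
      have "y \<in> L (d/2)" if "y \<in> cball 0 1" "dist z y < d/2" for y
      proof -
        have "d / 2 \<le> dist k y" if "k \<in> K" for k
        proof -
          have "d \<le> dist k z" using that d(2) by (auto simp: L_def)
          then show ?thesis
            using \<open>dist z y < d/2\<close> dist_triangle[of k z y] by (simp add: dist_commute)
        qed
        then show ?thesis using that by (simp add: L_def)
      qed
      then show ?thesis by (auto simp: L_def)
    qed
    then have "at z within cball 0 1 = at z within L (d/2)"
      using d by (intro at_within_nhd[of z "ball z (d/2)"]) auto
    moreover have "z \<in> L (d/2)" using d by (force simp: L_def)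
    ultimately show ?thesis
      using L_cont[of "d/2"] d by (simp add: continuous_on_eq_continuous_within)
  qed
  have Q_hol: "Q holomorphic_on ball 0 1"
  proof (rule holomorphic_uniform_sequence[OF open_ball])
    show "(\<lambda>z. \<Sum>i<n. q i z) holomorphic_on ball 0 1" for n
      by (intro holomorphic_intros q_hol)
    fix x :: complex assume x: "x \<in> ball 0 1"
    define d where "d = (1 - norm x) / 2"
    have d: "d > 0" using x by (simp add: d_def)
    have n: "norm y \<le> 1 - d" if "y \<in> cball x d" for y
    proof -
      have "norm (y - x) \<le> d" using that by (simp add: dist_norm norm_minus_commute)
      then show ?thesis using norm_triangle_sub[of y x] by (simp add: d_def field_simps)
    qed
    have "cball x d \<subseteq> L d"
    proof
      fix y assume y: "y \<in> cball x d"
      have "d \<le> dist k y" if "k \<in> K" for k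
      proof -
        have "norm k = 1" using that K by auto
        then show ?thesis using n[OF y] norm_triangle_sub[of k y] by (simp add: dist_norm)
      qed
      then show "y \<in> L d" using n[OF y] d by (simp add: L_def)
    qed
    moreover have "cball x d \<subseteq> ball 0 1" using n d by fastforce
    ultimately show "\<exists>d>0. cball x d \<subseteq> ball 0 1 \<and>
        uniform_limit (cball x d) (\<lambda>n z. \<Sum>i<n. q i z) Q sequentially"
      using d unif uniform_limit_on_subset by blast
  qed
  have Re_sums: "(\<lambda>n. Re (q n z)) sums Re (Q z)" if "z \<in> cball 0 1 - K" for z
    using sums[OF that] by (rule sums_Re)
  have Re_Q: "0 \<le> Re (Q z)" if "z \<in> cball 0 1 - K" for z
    using Re_sums[OF that] Re_q that by (metis DiffD1 sums_iff suminf_nonneg)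
  have nz: "1 + Q z \<noteq> 0" if "z \<in> cball 0 1 - K" for z
  proof
    assume "1 + Q z = 0"
    then have "Re (1 + Q z) = 0" by simp
    with Re_Q[OF that] show False by simp
  qed
  define p where "p = (\<lambda>z. if z \<in> K then 0 else 1 / (1 + Q z))"
  have disj: "ball 0 1 \<inter> K = {}" using K by auto
  show thesis
  proof (rule that[of p])
    have "1 + Q z \<noteq> 0" if "z \<in> ball 0 1" for z
      by (rule nz) (use disj that in auto)
    then have "(\<lambda>z. 1 / (1 + Q z)) holomorphic_on ball 0 1"
      by (intro holomorphic_intros Q_hol)
    then show "p holomorphic_on ball 0 1"
      by (rule holomorphic_transform) (use disj in \<open>auto simp: p_def\<close>)
    show "p z = 0 \<longleftrightarrow> z \<in> K" if "z \<in> cball 0 1" for z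
      using nz that by (auto simp: p_def)
    show "continuous_on (cball 0 1) p"
      unfolding continuous_on_eq_continuous_within
    proof
      fix z :: complex assume z: "z \<in> cball 0 1"
      show "continuous (at z within cball 0 1) p"
      proof (cases "z \<in> K")
        case False
        have "continuous (at z within cball 0 1) (\<lambda>z. 1 / (1 + Q z))"
          using False z nz by (intro continuous_intros Q_cont) auto
        moreover have "open (- K)" using K by auto
        then have "eventually (\<lambda>y. y \<in> - K) (at z within cball 0 1)"
          using False by (intro topological_tendstoD[OF tendsto_ident_at]) auto
        then have "eventually (\<lambda>y. 1 / (1 + Q y) = p y) (at z within cball 0 1)"
          by eventually_elim (auto simp: p_def)
        ultimately show ?thesis
          using False unfolding continuous_within p_def
          by (auto elim: Lim_transform_eventually)
      next
        case True
        have "(p \<longlongrightarrow> 0) (at z within cball 0 1)"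
        proof (rule tendstoI)
          fix \<epsilon> :: real assume "\<epsilon> > 0"
          \<comment> \<open>Where the first \<open>N\<close> covers all contain \<open>y\<close>, the real part of \<open>Q y\<close> is at least \<open>N / 4\<close>.\<close>
          obtain N :: nat where N: "4 / \<epsilon> < real N" using reals_Archimedean2 by blast
          define U where "U = (\<Inter>n<N. \<Union>t\<in>T n. ball t (\<delta> n))"
          have "open U" unfolding U_def by (intro open_INT open_UN) auto
          moreover have "z \<in> U" using True subsetD[OF K_covered] unfolding U_def by blast
          ultimately have "eventually (\<lambda>y. y \<in> U) (at z within cball 0 1)"
            by (intro topological_tendstoD[OF tendsto_ident_at]) auto
          moreover have "eventually (\<lambda>y. y \<in> cball 0 1) (at z within cball 0 1)"
            by (simp add: eventually_at_filter)
          ultimately show "eventually (\<lambda>y. dist (p y) 0 < \<epsilon>) (at z within cball 0 1)"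
          proof eventually_elim
            case (elim y)
            show ?case
            proof (cases "y \<in> K")
              case False
              then have y: "y \<in> cball 0 1 - K" using elim by simp
              have "(\<Sum>n<N. 1/4) \<le> (\<Sum>n<N. Re (q n y))"
                using elim by (intro sum_mono Re_q_near) (auto simp: U_def)
              also have "\<dots> \<le> Re (Q y)"
                using Re_sums[OF y] Re_q[OF elim(2)] by (metis sums_iff sum_le_suminf finite_lessThan)
              finally have "real N / 4 \<le> Re (Q y)" by simp
              also have "\<dots> \<le> norm (1 + Q y)" using complex_Re_le_cmod[of "1 + Q y"] by simp
              finally have "1 / \<epsilon> < norm (1 + Q y)" using N by (simp add: field_simps)
              moreover have "0 < norm (1 + Q y)" using nz[OF y] by simp
              ultimately show ?thesis
                using False \<open>\<epsilon> > 0\<close> by (simp add: p_def norm_divide field_simps)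
            qed (use \<open>\<epsilon> > 0\<close> in \<open>simp add: p_def\<close>)
          qed
        qed
        then show ?thesis using True by (simp add: continuous_within p_def)
      qed
    qed
  qed
qed

section \<open>Blaschke products\<close>

definition vanishes_to_order :: "nat \<Rightarrow> (complex \<Rightarrow> complex) \<Rightarrow> complex \<Rightarrow> bool" where
  "vanishes_to_order p f z \<longleftrightarrow> (\<forall>i<p. (deriv ^^ i) f z = 0)"

text \<open>In the Leibniz sum each term contains a derivative of \<open>f\<close> of order below \<open>p\<close> or one of \<open>g\<close> of order
  below \<open>q\<close>.\<close>

lemma vanishes_to_order_mult:
  assumes "f holomorphic_on S" "g holomorphic_on S" "open S" "z \<in> S"
    and "vanishes_to_order p f z" "vanishes_to_order q g z"
  shows "vanishes_to_order (p + q) (\<lambda>w. f w * g w) z"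
  unfolding vanishes_to_order_def
proof (intro allI impI)
  fix n assume "n < p + q"
  then have "i < p \<or> n - i < q" if "i \<le> n" for i using that by linarith
  then have "(deriv ^^ i) f z = 0 \<or> (deriv ^^ (n - i)) g z = 0" if "i \<le> n" for i
    using assms(5,6) that by (auto simp: vanishes_to_order_def)
  then show "(deriv ^^ n) (\<lambda>w. f w * g w) z = 0"
    unfolding higher_deriv_mult[OF assms(1-4)] by (intro sum.neutral) auto
qed

lemma vanishes_to_order_power:
  assumes "f holomorphic_on S" "open S" "z \<in> S" "f z = 0"
  shows "vanishes_to_order p (\<lambda>w. f w ^ p) z"
proof (induction p)
  case 0
  then show ?case by (simp add: vanishes_to_order_def)
next
  case (Suc p)
  have "vanishes_to_order 1 f z" using assms by (simp add: vanishes_to_order_def)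
  from vanishes_to_order_mult[OF assms(1) _ assms(2,3) this Suc]
  show ?case using assms(1) by (simp add: holomorphic_on_power)
qed

lemma vanishes_to_order_mult_left:
  assumes "f holomorphic_on S" "g holomorphic_on S" "open S" "z \<in> S" "vanishes_to_order p f z"
  shows "vanishes_to_order p (\<lambda>w. f w * g w) z"
  using vanishes_to_order_mult[OF assms(1-5), of 0] by (simp add: vanishes_to_order_def)

lemma vanishes_to_order_cong:
  assumes "vanishes_to_order p f z" "f holomorphic_on S" "open S" "z \<in> S"
    and "\<And>w. w \<in> S \<Longrightarrow> f w = g w"
  shows "vanishes_to_order p g z"
proof -
  have "g holomorphic_on S" using assms(2,5) by (rule holomorphic_transform)
  then show ?thesis
    using assms(1) higher_deriv_transform_within_open[OF assms(2) _ assms(3-5)]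
    by (simp add: vanishes_to_order_def)
qed

text \<open>The classical identity behind \<open>\<bar>\<phi>\<^sub>a\<bar> \<le> 1\<close>; it also bounds the denominator of a Blaschke factor from
  below by the distance to the zero.\<close>

lemma norm_one_minus_cnj_mult_ge:
  assumes "norm a \<le> 1" "norm z \<le> 1"
  shows "norm (z - a) \<le> norm (1 - cnj a * z)"
proof -
  have "(norm (1 - cnj a * z))\<^sup>2 - (norm (z - a))\<^sup>2 = (1 - (norm a)\<^sup>2) * (1 - (norm z)\<^sup>2)"
    by (simp add: cmod_power2) (simp add: power2_eq_square algebra_simps)
  moreover have "0 \<le> (1 - (norm a)\<^sup>2) * (1 - (norm z)\<^sup>2)"
    using assms by (intro mult_nonneg_nonneg) (auto simp: power_le_one)
  ultimately have "(norm (z - a))\<^sup>2 \<le> (norm (1 - cnj a * z))\<^sup>2" by linarith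
  then show ?thesis by (rule power2_le_imp_le) simp
qed

lemma one_minus_cnj_mult_nonzero:
  assumes "norm a < 1" "norm z \<le> 1"
  shows "1 - cnj a * z \<noteq> 0"
proof
  assume "1 - cnj a * z = 0"
  then have "norm (cnj a * z) = 1" by simp
  moreover have "norm a * norm z \<le> norm a * 1" using assms by (intro mult_left_mono) auto
  ultimately show False using assms by (simp add: norm_mult)
qed

lemma norm_blaschke_factor:
  "norm (blaschke_factor a z) = norm (z - a) / norm (1 - cnj a * z)"
  by (auto simp: blaschke_factor_def disk_involution_def norm_mult norm_divide norm_minus_commute)

lemma blaschke_factor_eq_0_iff:
  assumes "norm a < 1" "norm z \<le> 1"
  shows "blaschke_factor a z = 0 \<longleftrightarrow> z = a"
proof -
  have "blaschke_factor a z = 0 \<longleftrightarrow> norm (blaschke_factor a z) = 0" by simp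
  also have "\<dots> \<longleftrightarrow> z = a"
    unfolding norm_blaschke_factor using one_minus_cnj_mult_nonzero[OF assms] by simp
  finally show ?thesis .
qed

lemma norm_blaschke_factor_le_1:
  assumes "norm a < 1" "norm z \<le> 1"
  shows "norm (blaschke_factor a z) \<le> 1"
  unfolding norm_blaschke_factor
  using norm_one_minus_cnj_mult_ge[of a z] assms one_minus_cnj_mult_nonzero[OF assms]
  by (simp add: divide_le_eq_1)

lemma blaschke_factor_continuous:
  "norm a < 1 \<Longrightarrow> continuous_on (cball 0 1) (blaschke_factor a)"
  unfolding blaschke_factor_def disk_involution_def
  using one_minus_cnj_mult_nonzero by (intro continuous_intros) auto

lemma blaschke_factor_holomorphic:
  "norm a < 1 \<Longrightarrow> blaschke_factor a holomorphic_on ball 0 1"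
  unfolding blaschke_factor_def disk_involution_def
  using one_minus_cnj_mult_nonzero by (intro holomorphic_intros) auto

text \<open>This bound, summable over the zeros, is what makes the Blaschke product converge. It rests on the
  identity \<open>1 - b = (1 - \<bar>a\<bar>) (a + \<bar>a\<bar> z) / (a (1 - a\<^sup>* z))\<close> for the factor \<open>b\<close> with zero \<open>a \<noteq> 0\<close>.\<close>

lemma norm_one_minus_blaschke_factor_le:
  assumes a: "norm a < 1" and z: "norm z \<le> 1"
  shows "norm (1 - blaschke_factor a z) \<le> 2 * (1 - norm a) / norm (1 - cnj a * z)"
proof (cases "a = 0")
  case True
  then show ?thesis
    using z norm_triangle_ineq4[of 1 z] by (simp add: blaschke_factor_def disk_involution_def)
next
  case False
  define w where "w = 1 - cnj a * z"
  have w: "w \<noteq> 0" using one_minus_cnj_mult_nonzero[OF a z] by (simp add: w_def)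
  have "a * w - of_real (norm a) * (a - z) = (1 - of_real (norm a)) * (a + of_real (norm a) * z)"
  proof -
    have "a * cnj a = of_real (norm a) * of_real (norm a)"
      by (simp add: complex_norm_square[symmetric] power2_eq_square[symmetric])
    then show ?thesis by (simp add: w_def algebra_simps)
  qed
  moreover have "blaschke_factor a z = of_real (norm a) * (a - z) / (a * w)"
    using False by (simp add: blaschke_factor_def disk_involution_def w_def)
  then have "1 - blaschke_factor a z = (a * w - of_real (norm a) * (a - z)) / (a * w)"
    using False w by (simp add: diff_divide_distrib)
  ultimately have "1 - blaschke_factor a z
      = (1 - of_real (norm a)) * (a + of_real (norm a) * z) / (a * w)"
    by simp
  moreover have "norm (1 - of_real (norm a) :: complex) = 1 - norm a"
    using a by (metis abs_of_pos diff_gt_0_iff_gt norm_of_real of_real_1 of_real_diff)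
  ultimately have "norm (1 - blaschke_factor a z)
      = (1 - norm a) * norm (a + of_real (norm a) * z) / (norm a * norm w)"
    by (simp add: norm_divide norm_mult)
  also have "\<dots> \<le> (1 - norm a) * (norm a * 2) / (norm a * norm w)"
  proof (intro divide_right_mono mult_left_mono)
    have "norm (a + of_real (norm a) * z) \<le> norm a + norm a * norm z"
      using norm_triangle_ineq[of a "of_real (norm a) * z"] by (simp add: norm_mult)
    also have "norm a * norm z \<le> norm a * 1" using z by (intro mult_left_mono) auto
    finally show "norm (a + of_real (norm a) * z) \<le> norm a * 2" by simp
  qed (use a in auto)
  also have "\<dots> = 2 * (1 - norm a) / norm w"
    using False by simp
  finally show ?thesis by (simp add: w_def)
qed

definition blaschke_term ::
    "nat set \<Rightarrow> (nat \<Rightarrow> complex) \<Rightarrow> (nat \<Rightarrow> nat) \<Rightarrow> nat \<Rightarrow> complex \<Rightarrow> complex" where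
  "blaschke_term I a m k z = (if k \<in> I then blaschke_factor (a k) z ^ m k else 1)"

definition blaschke_product ::
    "nat set \<Rightarrow> (nat \<Rightarrow> complex) \<Rightarrow> (nat \<Rightarrow> nat) \<Rightarrow> complex \<Rightarrow> complex" where
  "blaschke_product I a m z = (\<Prod>k. blaschke_term I a m k z)"

text \<open>A uniform lower bound \<open>c\<close> for the denominators holds on compact subsets of the open disk as well as
  near boundary points away from the closure of the zeros, so one convergence statement serves both
  for holomorphy inside and for continuity up to the circle.\<close>

lemma blaschke_product_uniform_limit:
  fixes a :: "nat \<Rightarrow> complex"
  assumes a: "\<And>k. k \<in> I \<Longrightarrow> norm (a k) < 1"
    and sum: "(\<lambda>k. real (m k) * (1 - norm (a k))) summable_on I"
    and S: "compact S" "S \<subseteq> cball 0 1"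
    and c: "c > 0" "\<And>k z. \<lbrakk>k \<in> I; z \<in> S\<rbrakk> \<Longrightarrow> c \<le> norm (1 - cnj (a k) * z)"
  shows "uniform_limit S (\<lambda>n z. \<Prod>k<n. blaschke_term I a m k z) (blaschke_product I a m) sequentially"
    and "\<And>z. \<lbrakk>z \<in> S; z \<notin> a ` I\<rbrakk> \<Longrightarrow> blaschke_product I a m z \<noteq> 0"
proof -
  define b where "b = blaschke_term I a m"
  have b_eq: "b k = (\<lambda>z. if k \<in> I then blaschke_factor (a k) z ^ m k else 1)" for k
    by (simp add: b_def blaschke_term_def fun_eq_iff)
  define M where "M = (\<lambda>k. (if k \<in> I then real (m k) * (1 - norm (a k)) else 0) * (2 / c))"
  have "(\<lambda>k. if k \<in> I then real (m k) * (1 - norm (a k)) else 0) summable_on UNIV"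
    using sum by (rule summable_on_cong_neutral[THEN iffD1, rotated -1]) auto
  then have "summable (\<lambda>k. if k \<in> I then real (m k) * (1 - norm (a k)) else 0)"
    by (rule summable_on_imp_summable)
  from summable_mult2[OF this, of "2 / c"] have M: "summable M"
    unfolding M_def .
  have bound: "norm (b k z - 1) \<le> M k" if z: "z \<in> S" for k z
  proof (cases "k \<in> I")
    case True
    have z1: "norm z \<le> 1" using z S by auto
    have "norm (b k z - 1) \<le> real (m k) * norm (blaschke_factor (a k) z - 1)"
      using norm_power_diff[of "blaschke_factor (a k) z" 1 "m k"]
        norm_blaschke_factor_le_1[OF a[OF True] z1] True by (simp add: b_eq)
    also have "\<dots> \<le> real (m k) * (2 * (1 - norm (a k)) / c)"
    proof (intro mult_left_mono)
      have "norm (blaschke_factor (a k) z - 1) \<le> 2 * (1 - norm (a k)) / norm (1 - cnj (a k) * z)"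
        using norm_one_minus_blaschke_factor_le[OF a[OF True] z1] by (simp add: norm_minus_commute)
      also have "\<dots> \<le> 2 * (1 - norm (a k)) / c"
      proof (rule divide_left_mono)
        have "0 < norm (1 - cnj (a k) * z)" using c(1) c(2)[OF True z] by linarith
        then show "0 < norm (1 - cnj (a k) * z) * c" using c(1) by (rule mult_pos_pos)
      qed (use c(2)[OF True z] a[OF True] in auto)
      finally show "norm (blaschke_factor (a k) z - 1) \<le> 2 * (1 - norm (a k)) / c" .
    qed auto
    also have "\<dots> = M k" using True c(1) by (simp add: M_def field_simps)
    finally show ?thesis .
  qed (auto simp: b_eq M_def)
  have cont: "continuous_on S (b k)" for k
  proof (cases "k \<in> I")
    case True
    then show ?thesis
      using continuous_on_subset[OF blaschke_factor_continuous[OF a[OF True]] S(2)]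
      by (auto simp: b_eq intro!: continuous_intros)
  qed (simp add: b_eq)
  have "uniformly_convergent_on S (\<lambda>n z. \<Sum>k<n. norm (b k z - 1))"
    by (rule Weierstrass_m_test'[OF _ M]) (use bound in simp)
  then have conv: "uniformly_convergent_on S (\<lambda>n z. \<Prod>k<n. b k z)"
    using cont S(1) by (intro uniformly_convergent_on_prod') auto
  have cp: "convergent_prod (\<lambda>k. b k z)" if z: "z \<in> S" for z
  proof -
    have "summable (\<lambda>k. norm (b k z - 1))"
      using bound[OF z] by (intro summable_comparison_test[OF _ M]) auto
    then show ?thesis
      by (intro abs_convergent_prod_imp_convergent_prod summable_imp_abs_convergent_prod)
  qed
  have "(\<lambda>n. \<Prod>k<n. b k z) \<longlonglongrightarrow> (\<Prod>k. b k z)" if "z \<in> S" for z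
    using has_prod_imp_tendsto'[OF convergent_prod_has_prod[OF cp[OF that]]] .
  then have eq: "lim (\<lambda>n. \<Prod>k<n. b k z) = (\<Prod>k. b k z)" if "z \<in> S" for z
    using that by (intro limI)
  have "uniform_limit S (\<lambda>n z. \<Prod>k<n. b k z) (\<lambda>z. \<Prod>k. b k z) sequentially"
    by (rule iffD1[OF uniform_limit_cong'[OF refl eq] conv[unfolded uniformly_convergent_uniform_limit_iff]])
  then show "uniform_limit S (\<lambda>n z. \<Prod>k<n. blaschke_term I a m k z) (blaschke_product I a m) sequentially"
    by (simp add: b_def blaschke_product_def[abs_def])
  have "(\<Prod>k. b k z) \<noteq> 0" if "z \<in> S" "z \<notin> a ` I" for z
  proof (rule prodinf_nonzero[OF cp[OF that(1)]])
    fix k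
    show "b k z \<noteq> 0"
    proof (cases "k \<in> I")
      case True
      have "norm z \<le> 1" "z \<noteq> a k" using that S True by auto
      then show ?thesis using True blaschke_factor_eq_0_iff[OF a[OF True]] by (simp add: b_eq)
    qed (simp add: b_eq)
  qed
  then show "blaschke_product I a m z \<noteq> 0" if "z \<in> S" "z \<notin> a ` I" for z
    using that by (simp add: b_def blaschke_product_def)
qed

text \<open>Continuity can fail only at the points of the circle where zeros accumulate. The orders of vanishing pass
  to the limit because the derivatives of the partial products converge to those of the product.\<close>

lemma blaschke_product_properties:
  fixes a :: "nat \<Rightarrow> complex"
  assumes a: "\<And>k. k \<in> I \<Longrightarrow> norm (a k) < 1"
    and sum: "(\<lambda>k. real (m k) * (1 - norm (a k))) summable_on I"
  defines "P \<equiv> blaschke_product I a m"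
  shows "P holomorphic_on ball 0 1"
    and "continuous_on (cball 0 1 - closure (a ` I) \<inter> sphere 0 1) P"
    and "\<And>z. z \<in> cball 0 1 - closure (a ` I) \<inter> sphere 0 1 \<Longrightarrow> norm (P z) \<le> 1"
    and "\<And>z. z \<in> cball 0 1 - closure (a ` I) \<Longrightarrow> P z \<noteq> 0"
    and "\<And>k. k \<in> I \<Longrightarrow> vanishes_to_order (m k) P (a k)"
proof -
  define b where "b = blaschke_term I a m"
  have b_eq: "b k = (\<lambda>z. if k \<in> I then blaschke_factor (a k) z ^ m k else 1)" for k
    by (simp add: b_def blaschke_term_def fun_eq_iff)
  \<comment> \<open>Inside the disk \<open>1 - \<bar>z\<bar>\<close> controls the denominators, on the circle the distance to the zeros does.\<close>
  have local_bound: "\<exists>d>0. \<exists>c>0. \<forall>k\<in>I. \<forall>w\<in>cball z d \<inter> cball 0 1. c \<le> norm (1 - cnj (a k) * w)"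
    if z: "z \<in> cball 0 1 - closure (a ` I) \<inter> sphere 0 1" for z
  proof (cases "z \<in> ball 0 1")
    case True
    define d where "d = (1 - norm z) / 2"
    have d: "d > 0" using True by (simp add: d_def)
    have "d \<le> norm (1 - cnj (a k) * w)" if k: "k \<in> I" and w: "w \<in> cball z d" for k w
    proof -
      have "norm (w - z) \<le> d" using w by (simp add: dist_norm norm_minus_commute)
      then have w1: "norm w \<le> 1 - d" using norm_triangle_sub[of w z] by (simp add: d_def field_simps)
      have "norm (a k) * norm w \<le> 1 * norm w" using a[OF k] by (intro mult_right_mono) auto
      then have "norm (cnj (a k) * w) \<le> 1 - d" using w1 by (simp add: norm_mult)
      then show ?thesis using norm_triangle_ineq2[of 1 "cnj (a k) * w"] by simp
    qed
    then show ?thesis using d by blast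
  next
    case False
    then have "z \<in> - closure (a ` I)" using z by auto
    then obtain d where d: "d > 0" "ball z d \<subseteq> - closure (a ` I)"
      using open_contains_ball[of "- closure (a ` I)"] by auto
    have "d / 2 \<le> norm (1 - cnj (a k) * w)" if k: "k \<in> I" and w: "w \<in> cball z (d / 2) \<inter> cball 0 1" for k w
    proof -
      have "a k \<notin> ball z d" using d(2) k closure_subset[of "a ` I"] by blast
      then have "d \<le> dist z (a k)" by simp
      then have "d / 2 \<le> norm (w - a k)"
        using w dist_triangle[of z "a k" w] by (simp add: dist_norm[symmetric])
      then show ?thesis using norm_one_minus_cnj_mult_ge[of "a k" w] a[OF k] w by simp
    qed
    then show ?thesis using d(1) half_gt_zero by blast
  qed
  have nbhd: "\<exists>d>0. uniform_limit (cball z d \<inter> cball 0 1) (\<lambda>n z. \<Prod>k<n. b k z) P sequentially"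
    if z: "z \<in> cball 0 1 - closure (a ` I) \<inter> sphere 0 1" for z
  proof -
    obtain d c where d: "d > 0" "c > 0"
      "\<And>k w. \<lbrakk>k \<in> I; w \<in> cball z d \<inter> cball 0 1\<rbrakk> \<Longrightarrow> c \<le> norm (1 - cnj (a k) * w)"
      using local_bound[OF z] by blast
    have C: "compact (cball z d \<inter> cball 0 1)" "cball z d \<inter> cball 0 1 \<subseteq> cball 0 1"
      by (auto simp: compact_Int)
    have "uniform_limit (cball z d \<inter> cball 0 1) (\<lambda>n z. \<Prod>k<n. b k z) P sequentially"
      unfolding P_def b_def by (rule blaschke_product_uniform_limit(1)[OF a sum C d(2,3)])
    then show ?thesis using d(1) by (intro exI[of _ d] conjI)
  qed
  have b_hol: "b k holomorphic_on ball 0 1" for k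
    by (cases "k \<in> I") (auto simp: b_eq intro!: holomorphic_intros blaschke_factor_holomorphic a)
  have b_cont: "continuous_on (cball 0 1) (b k)" for k
    by (cases "k \<in> I") (auto simp: b_eq intro!: continuous_intros blaschke_factor_continuous a)
  have nbhd_ball: "\<exists>d>0. cball z d \<subseteq> ball 0 1 \<and> uniform_limit (cball z d) (\<lambda>n z. \<Prod>k<n. b k z) P sequentially"
    if z: "z \<in> ball 0 1" for z
  proof -
    have z': "z \<in> cball 0 1 - closure (a ` I) \<inter> sphere 0 1" using z by auto
    obtain d where d: "d > 0" "uniform_limit (cball z d \<inter> cball 0 1) (\<lambda>n z. \<Prod>k<n. b k z) P sequentially"
      using nbhd[OF z'] by blast
    obtain e where e: "e > 0" "cball z e \<subseteq> ball 0 1"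
      using z by (meson open_ball open_contains_cball)
    have "cball z (min d e) \<subseteq> cball z d" "cball z (min d e) \<subseteq> cball z e"
      by (auto intro: subset_cball)
    then have sub: "cball z (min d e) \<subseteq> cball z d \<inter> cball 0 1" "cball z (min d e) \<subseteq> ball 0 1"
      using e(2) ball_subset_cball[of "0::complex" 1] by blast+
    show ?thesis
      using uniform_limit_on_subset[OF d(2) sub(1)] sub(2) d(1) e(1)
      by (intro exI[of _ "min d e"] conjI) (simp_all only: min_less_iff_conj)
  qed
  show hol: "P holomorphic_on ball 0 1"
    by (rule holomorphic_uniform_sequence[OF open_ball _ nbhd_ball])
       (auto intro!: holomorphic_intros b_hol)
  show "continuous_on (cball 0 1 - closure (a ` I) \<inter> sphere 0 1) P"
    unfolding continuous_on_eq_continuous_within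
  proof
    fix z :: complex assume z: "z \<in> cball 0 1 - closure (a ` I) \<inter> sphere 0 1"
    obtain d where d: "d > 0" "uniform_limit (cball z d \<inter> cball 0 1) (\<lambda>n z. \<Prod>k<n. b k z) P sequentially"
      using nbhd[OF z] by blast
    have "continuous_on (cball z d \<inter> cball 0 1) P"
      by (rule uniform_limit_theorem[OF _ d(2)])
         (auto intro!: always_eventually continuous_on_prod continuous_on_subset[OF b_cont])
    then have "continuous (at z within cball z d \<inter> cball 0 1) P"
      using z d(1) by (simp add: continuous_on_eq_continuous_within)
    moreover have "at z within cball z d \<inter> cball 0 1 = at z within cball 0 1"
      using d(1) by (intro at_within_nhd[of z "ball z d"]) auto
    ultimately have "continuous (at z within cball 0 1) P" by simp
    then show "continuous (at z within cball 0 1 - closure (a ` I) \<inter> sphere 0 1) P"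
      by (rule continuous_within_subset) auto
  qed
  show "norm (P z) \<le> 1" if z: "z \<in> cball 0 1 - closure (a ` I) \<inter> sphere 0 1" for z
  proof -
    obtain d where d: "d > 0" "uniform_limit (cball z d \<inter> cball 0 1) (\<lambda>n z. \<Prod>k<n. b k z) P sequentially"
      using nbhd[OF z] by blast
    have "(\<lambda>n. \<Prod>k<n. b k z) \<longlonglongrightarrow> P z"
      by (rule tendsto_uniform_limitI[OF d(2)]) (use d(1) z in auto)
    moreover have "norm (b k z) \<le> 1" for k
      using norm_blaschke_factor_le_1[OF a, of k z] z by (auto simp: b_eq norm_power intro!: power_le_one)
    then have "norm (\<Prod>k<n. b k z) \<le> 1" for n
      unfolding prod_norm[symmetric] by (intro prod_le_1) auto
    ultimately show ?thesis
      by (intro Lim_bounded[OF tendsto_norm]) auto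
  qed
  show "P z \<noteq> 0" if z: "z \<in> cball 0 1 - closure (a ` I)" for z
  proof -
    have z': "z \<in> cball 0 1 - closure (a ` I) \<inter> sphere 0 1" "z \<notin> a ` I"
      using z closure_subset[of "a ` I"] by auto
    obtain d c where d: "d > 0" "c > 0"
      "\<And>k w. \<lbrakk>k \<in> I; w \<in> cball z d \<inter> cball 0 1\<rbrakk> \<Longrightarrow> c \<le> norm (1 - cnj (a k) * w)"
      using local_bound[OF z'(1)] by blast
    have "c \<le> norm (1 - cnj (a k) * w)" if "k \<in> I" "w \<in> {z}" for k w
      using d(1) z that by (intro d(3)) auto
    then show ?thesis
      unfolding P_def b_def using z z'(2) d(2)
      by (intro blaschke_product_uniform_limit(2)[OF a sum, of "{z}" c]) auto
  qed
  show "vanishes_to_order (m k) P (a k)" if k: "k \<in> I" for k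
    unfolding vanishes_to_order_def
  proof (intro allI impI)
    fix i assume i: "i < m k"
    obtain d where d: "d > 0" "cball (a k) d \<subseteq> ball 0 1"
      "uniform_limit (cball (a k) d) (\<lambda>n z. \<Prod>k<n. b k z) P sequentially"
      using nbhd_ball[of "a k"] a[OF k] by auto
    have prod_hol: "(\<lambda>z. \<Prod>k\<in>J. b k z) holomorphic_on ball 0 1" for J
      by (intro holomorphic_intros b_hol)
    have "(\<lambda>n. (deriv ^^ i) (\<lambda>z. \<Prod>k<n. b k z) (a k)) \<longlonglongrightarrow> (deriv ^^ i) P (a k)"
    proof (rule higher_deriv_complex_uniform_limit)
      show "uniform_limit (ball (a k) d) (\<lambda>n z. \<Prod>k<n. b k z) P sequentially"
        using d(3) by (rule uniform_limit_on_subset) auto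
      show "\<forall>\<^sub>F n in sequentially. (\<lambda>z. \<Prod>k<n. b k z) holomorphic_on ball (a k) d"
        using holomorphic_on_subset[OF prod_hol] d(2) ball_subset_cball[of "a k" d]
        by (intro always_eventually) blast
    qed (use d in auto)
    moreover have "(deriv ^^ i) (\<lambda>z. \<Prod>k<n. b k z) (a k) = 0" if "n > k" for n
    proof -
      have "vanishes_to_order (m k) (\<lambda>w. blaschke_factor (a k) w ^ m k) (a k)"
        by (rule vanishes_to_order_power[OF blaschke_factor_holomorphic[OF a[OF k]]])
           (use a[OF k] in \<open>auto simp: blaschke_factor_eq_0_iff\<close>)
      then have "vanishes_to_order (m k) (b k) (a k)" using k by (simp add: b_eq)
      then have "vanishes_to_order (m k) (\<lambda>z. b k z * (\<Prod>k\<in>{..<n} - {k}. b k z)) (a k)"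
        by (rule vanishes_to_order_mult_left[OF b_hol prod_hol open_ball, rotated]) (use a[OF k] in auto)
      moreover have "(\<lambda>z. b k z * (\<Prod>k\<in>{..<n} - {k}. b k z)) = (\<lambda>z. \<Prod>k<n. b k z)"
        using that by (simp add: prod.remove[of "{..<n}" k])
      ultimately show ?thesis using i by (simp add: vanishes_to_order_def)
    qed
    then have "(\<lambda>n. (deriv ^^ i) (\<lambda>z. \<Prod>k<n. b k z) (a k)) \<longlonglongrightarrow> 0"
      by (intro tendsto_eventually) (auto intro: eventually_mono[OF eventually_gt_at_top[of k]])
    ultimately show "(deriv ^^ i) P (a k) = 0" by (rule LIMSEQ_unique)
  qed
qed

section \<open>The algebra of a Blaschke product\<close>

text \<open>The function is the Blaschke product times a Fatou function for the part of the closure of the zeros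
  on the circle; that this part has length zero is witnessed by \<open>f\<close>. The product extends
  continuously by \<open>0\<close> across that part because the Blaschke product is bounded by \<open>1\<close>.\<close>

lemma zero_data_function:
  fixes a :: "nat \<Rightarrow> complex"
  assumes a: "\<And>k. k \<in> I \<Longrightarrow> norm (a k) < 1"
    and sum: "(\<lambda>k. real (m k) * (1 - norm (a k))) summable_on I"
    and f: "f \<in> disk_algebra" "\<And>k. k \<in> I \<Longrightarrow> f (a k) = 0"
    and b: "\<beta> \<in> ball 0 1" "f \<beta> \<noteq> 0"
  obtains h where "h \<in> disk_algebra" "\<And>k. k \<in> I \<Longrightarrow> vanishes_to_order (m k) h (a k)"
    "\<And>z. z \<in> cball 0 1 - closure (a ` I) \<Longrightarrow> h z \<noteq> 0"
proof -
  have f': "f holomorphic_on ball 0 1" "continuous_on (cball 0 1) f"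
    using f(1) by (auto simp: disk_algebra_def)
  define K where "K = closure (a ` I) \<inter> sphere 0 1"
  have K: "closed K" "K \<subseteq> sphere 0 1" by (auto simp: K_def)
  have "a ` I \<subseteq> cball 0 1" using a by force
  then have clo: "closure (a ` I) \<subseteq> cball 0 1" by (rule closure_minimal) simp
  have f0: "f x = 0" if "x \<in> closure (a ` I)" for x
    using continuous_constant_on_closure[OF continuous_on_subset[OF f'(2) clo], of 0] f(2) that by auto
  have "\<exists>T \<delta>. finite T \<and> T \<subseteq> sphere 0 1 \<and> \<delta> > 0 \<and> real (card T) * \<delta> < \<epsilon> \<and> K \<subseteq> (\<Union>t\<in>T. ball t \<delta>)"
    if \<epsilon>: "\<epsilon> > 0" for \<epsilon> :: real
  proof -
    obtain T \<delta> where T: "finite T" "T \<subseteq> sphere 0 1" "\<delta> > 0" "real (card T) * \<delta> < \<epsilon>"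
      "{z \<in> sphere 0 1. f z = 0} \<subseteq> (\<Union>t\<in>T. ball t \<delta>)"
      by (rule boundary_zeros_length_zero[OF f' b \<epsilon>])
    have "K \<subseteq> {z \<in> sphere 0 1. f z = 0}" using f0 by (auto simp: K_def)
    from subset_trans[OF this T(5)] T(1-4) show ?thesis by (intro exI conjI)
  qed
  from Fatou_vanishing_function[OF K this]
  obtain p where p: "p holomorphic_on ball 0 1" "continuous_on (cball 0 1) p"
    "\<And>z. z \<in> cball 0 1 \<Longrightarrow> p z = 0 \<longleftrightarrow> z \<in> K" by blast
  define P where "P = blaschke_product I a m"
  note P = blaschke_product_properties[OF a sum, folded P_def K_def]
  define g where "g = (\<lambda>z. if z \<in> K then 0 else P z * p z)"
  have ball_K: "z \<notin> K" if "z \<in> ball 0 1" for z using that K by auto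
  have g_hol: "g holomorphic_on ball 0 1"
    by (rule holomorphic_transform[OF holomorphic_on_mult[OF P(1) p(1)]]) (use ball_K in \<open>auto simp: g_def\<close>)
  have g_cont: "continuous_on (cball 0 1) g"
    unfolding continuous_on_eq_continuous_within
  proof
    fix z :: complex assume z: "z \<in> cball 0 1"
    show "continuous (at z within cball 0 1) g"
    proof (cases "z \<in> K")
      case False
      have "continuous_on (cball 0 1 - K) (\<lambda>z. P z * p z)"
        by (intro continuous_on_mult P(2) continuous_on_subset[OF p(2)]) auto
      then have "continuous_on (cball 0 1 - K) g"
        by (rule continuous_on_eq) (auto simp: g_def)
      then have "continuous (at z within (cball 0 1 - K)) g"
        using z False by (simp add: continuous_on_eq_continuous_within)
      moreover have "at z within (cball 0 1 - K) = at z within cball 0 1"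
        using K(1) False by (intro at_within_nhd[of z "- K"]) auto
      ultimately show ?thesis by simp
    next
      case True
      have "(p \<longlongrightarrow> 0) (at z within cball 0 1)"
        using continuous_on_def[THEN iffD1, OF p(2)] p(3)[OF z] z True by fastforce
      moreover have "eventually (\<lambda>y. norm (g y) \<le> norm (p y)) (at z within cball 0 1)"
      proof -
        have "norm (g y) \<le> norm (p y)" if "y \<in> cball 0 1" for y
        proof (cases "y \<in> K")
          case False
          then have "norm (P y) * norm (p y) \<le> 1 * norm (p y)"
            using P(3)[of y] that by (intro mult_right_mono) auto
          then show ?thesis using False by (simp add: g_def norm_mult)
        qed (simp add: g_def)
        then show ?thesis by (simp add: eventually_at_filter)
      qed
      ultimately have "(g \<longlongrightarrow> 0) (at z within cball 0 1)"
        by (intro Lim_null_comparison[of g "\<lambda>y. norm (p y)"] tendsto_norm_zero)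
      then show ?thesis using True by (simp add: continuous_within g_def)
    qed
  qed
  show thesis
  proof (rule that[of "on_disk g"])
    show "on_disk g \<in> disk_algebra" using g_hol g_cont by (rule on_disk_in_disk_algebra)
    show "vanishes_to_order (m k) (on_disk g) (a k)" if k: "k \<in> I" for k
    proof (rule vanishes_to_order_cong[OF _ holomorphic_on_mult[OF P(1) p(1)] open_ball])
      have van: "vanishes_to_order (m k) P (a k)" by (rule P(5)[OF _ k])
      show "a k \<in> ball 0 1" using a[OF k] by simp
      then show "vanishes_to_order (m k) (\<lambda>z. P z * p z) (a k)"
        using P(1) p(1) van by (intro vanishes_to_order_mult_left[where S = "ball 0 1"]) simp_all
      show "P w * p w = on_disk g w" if "w \<in> ball 0 1" for w
        using ball_K[OF that] that by (auto simp: on_disk_def g_def)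
    qed
    show "on_disk g z \<noteq> 0" if z: "z \<in> cball 0 1 - closure (a ` I)" for z
    proof -
      have "z \<notin> K" using z by (simp add: K_def)
      then show ?thesis using z P(4)[OF _ z] p(3)[of z] by (simp add: on_disk_def g_def)
    qed
  qed
qed

definition vanishing_ideal :: "enat \<Rightarrow> (nat \<Rightarrow> complex) \<Rightarrow> (nat \<Rightarrow> nat) \<Rightarrow> (complex \<Rightarrow> complex) set" where
  "vanishing_ideal N a m =
     {f \<in> disk_algebra. \<forall>k\<in>zero_index N. vanishes_to_order (m k) f (a k)}"

locale blaschke_zeros =
  fixes N :: enat and a :: "nat \<Rightarrow> complex" and m :: "nat \<Rightarrow> nat"
  assumes zero_in_disk: "k \<in> zero_index N \<Longrightarrow> norm (a k) < 1"
    and mult_pos: "k \<in> zero_index N \<Longrightarrow> 1 \<le> m k"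
    and blaschke_condition: "(\<lambda>k. real (m k) * (1 - norm (a k))) summable_on zero_index N"
begin

abbreviation "A \<equiv> disk_algebra_B N a m"
abbreviation "J \<equiv> vanishing_ideal N a m"
abbreviation "E \<equiv> a ` zero_index N"

lemma disk_algebra_B_subset: "A \<subseteq> disk_algebra"
  unfolding disk_algebra_B_def by blast

lemma in_vanishing_ideal_iff:
  "f \<in> J \<longleftrightarrow> f \<in> A \<and> (\<forall>k\<in>zero_index N. f (a k) = 0)"
proof
  assume f: "f \<in> J"
  have "(deriv ^^ n) f (a k) = 0" if "k \<in> zero_index N" "n \<le> m k - 1" for k n
    using f that mult_pos[of k] by (auto simp: vanishing_ideal_def vanishes_to_order_def)
  from this[of _ 0] this show "f \<in> A \<and> (\<forall>k\<in>zero_index N. f (a k) = 0)"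
    using f by (auto simp: disk_algebra_B_def vanishing_ideal_def)
next
  assume f: "f \<in> A \<and> (\<forall>k\<in>zero_index N. f (a k) = 0)"
  have fD: "f \<in> disk_algebra"
    and deriv_0: "\<And>k n. \<lbrakk>k \<in> zero_index N; 1 \<le> n; n \<le> m k - 1\<rbrakk> \<Longrightarrow> (deriv ^^ n) f (a k) = 0"
    using f unfolding disk_algebra_B_def by blast+
  have "(deriv ^^ i) f (a k) = 0" if k: "k \<in> zero_index N" and i: "i < m k" for k i
  proof (cases "i = 0")
    case True
    then show ?thesis using f k by simp
  next
    case False
    then show ?thesis using i by (intro deriv_0 k) auto
  qed
  then show "f \<in> J"
    using fD by (simp add: vanishing_ideal_def vanishes_to_order_def)
qed

text \<open>The first factor ranges over the whole disk algebra. This is what allows characters to be extended from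
  \<open>A\<close> to the disk algebra, and the separating functions to be built inside \<open>A\<close>.\<close>

lemma vanishing_ideal_mult:
  assumes "f \<in> disk_algebra" "g \<in> J"
  shows "(\<lambda>z. f z * g z) \<in> J"
proof -
  have "vanishes_to_order (m k) (\<lambda>z. g z * f z) (a k)" if "k \<in> zero_index N" for k
    by (rule vanishes_to_order_mult_left[of _ "ball 0 1"])
       (use assms that zero_in_disk in \<open>auto simp: vanishing_ideal_def disk_algebra_def\<close>)
  then show ?thesis
    using assms disk_algebra_mult by (auto simp: vanishing_ideal_def mult.commute)
qed

lemma disk_algebra_B_diff_const:
  assumes f: "f \<in> A"
  shows "(\<lambda>z. f z - c * on_disk (\<lambda>_. 1) z) \<in> A"
proof -
  let ?g = "\<lambda>z. f z - c * on_disk (\<lambda>_. 1) z"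
  have fD: "f \<in> disk_algebra" using f disk_algebra_B_subset by blast
  have g: "?g \<in> disk_algebra"
    by (intro disk_algebra_diff disk_algebra_const fD)
  have "(deriv ^^ n) ?g (a k) = 0" if k: "k \<in> zero_index N" and n: "1 \<le> n" "n \<le> m k - 1" for k n
  proof -
    have ak: "a k \<in> ball 0 1" using zero_in_disk[OF k] by simp
    have hol: "f holomorphic_on ball 0 1" "?g holomorphic_on ball 0 1"
      using fD g by (simp_all add: disk_algebra_def)
    have "(deriv ^^ n) ?g (a k) = (deriv ^^ n) (\<lambda>z. f z - c) (a k)"
      by (rule higher_deriv_transform_within_open[OF hol(2) _ open_ball ak])
         (auto simp: on_disk_def intro!: holomorphic_intros hol(1))
    also have "\<dots> = (deriv ^^ n) f (a k) - (deriv ^^ n) (\<lambda>_. c) (a k)"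
      by (rule higher_deriv_diff[OF hol(1) _ open_ball ak]) simp
    also have "\<dots> = 0" using f k n unfolding disk_algebra_B_def by simp
    finally show ?thesis .
  qed
  moreover have "?g (a j) = ?g (a k)" if "j \<in> zero_index N" "k \<in> zero_index N" for j k
  proof -
    have "f (a j) = f (a k)" using f that unfolding disk_algebra_B_def by blast
    then show ?thesis using zero_in_disk that by (simp add: on_disk_def less_imp_le)
  qed
  ultimately show ?thesis using g unfolding disk_algebra_B_def by blast
qed

lemma disk_algebra_B_const: "(\<lambda>z. c * on_disk (\<lambda>_. 1) z) \<in> A"
proof -
  have "(\<lambda>_. 0) \<in> A" by (simp add: disk_algebra_B_def disk_algebra_def)
  from disk_algebra_B_diff_const[OF this, of "- c"] show ?thesis by simp
qed

lemma common_value: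
  assumes "f \<in> A"
  obtains c where "\<And>k. k \<in> zero_index N \<Longrightarrow> f (a k) = c"
proof (cases "zero_index N = {}")
  case False
  then obtain j where "j \<in> zero_index N" by blast
  then show thesis
    using assms unfolding disk_algebra_B_def by (intro that[of "f (a j)"]) blast
qed (use that in auto)

lemma diff_common_value_in_ideal:
  assumes "f \<in> A" "\<And>k. k \<in> zero_index N \<Longrightarrow> f (a k) = c"
  shows "(\<lambda>z. f z - c * on_disk (\<lambda>_. 1) z) \<in> J"
  using disk_algebra_B_diff_const[OF assms(1), of c] assms(2) zero_in_disk
  by (auto simp: in_vanishing_ideal_iff on_disk_def less_imp_le)

lemma vanishing_ideal_add:
  assumes "f \<in> J" "g \<in> J"
  shows "(\<lambda>z. f z + g z) \<in> J"
proof -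
  have hol: "f holomorphic_on ball 0 1" "g holomorphic_on ball 0 1"
    and fg: "(\<lambda>z. f z + g z) \<in> disk_algebra"
    using assms disk_algebra_add[of f g] by (auto simp: vanishing_ideal_def disk_algebra_def)
  have "(deriv ^^ i) (\<lambda>z. f z + g z) (a k) = (deriv ^^ i) f (a k) + (deriv ^^ i) g (a k)"
    if "k \<in> zero_index N" for i k
    by (rule higher_deriv_add[OF hol open_ball]) (use zero_in_disk[OF that] in simp)
  then show ?thesis
    using assms fg by (auto simp: vanishing_ideal_def vanishes_to_order_def)
qed

lemma vanishing_ideal_cmult:
  assumes "f \<in> J"
  shows "(\<lambda>z. c * f z) \<in> J"
proof -
  have "(\<lambda>z. on_disk (\<lambda>_. 1) z * f z) = f"
    using assms by (intro on_disk_1_mult) (simp add: vanishing_ideal_def)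
  then have "(\<lambda>z. c * on_disk (\<lambda>_. 1) z * f z) = (\<lambda>z. c * f z)"
    by (simp add: mult.assoc fun_eq_iff)
  with vanishing_ideal_mult[OF disk_algebra_const assms, of c] show ?thesis by simp
qed

text \<open>The splitting \<open>A = J + \<complex>\<close>, from which the closure of \<open>A\<close> under the algebra operations follows
  without computing derivatives of products of elements that need not vanish at the zeros.\<close>

lemma disk_algebra_B_decomposition:
  "f \<in> A \<longleftrightarrow> (\<exists>c. (\<lambda>z. f z - c * on_disk (\<lambda>_. 1) z) \<in> J)"
proof
  assume f: "f \<in> A"
  obtain c where "\<And>k. k \<in> zero_index N \<Longrightarrow> f (a k) = c" using common_value[OF f] by blast
  from diff_common_value_in_ideal[OF f this]
  show "\<exists>c. (\<lambda>z. f z - c * on_disk (\<lambda>_. 1) z) \<in> J" by blast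
next
  assume "\<exists>c. (\<lambda>z. f z - c * on_disk (\<lambda>_. 1) z) \<in> J"
  then obtain c where "(\<lambda>z. f z - c * on_disk (\<lambda>_. 1) z) \<in> A"
    by (auto simp: in_vanishing_ideal_iff)
  from disk_algebra_B_diff_const[OF this, of "- c"] show "f \<in> A" by simp
qed

lemma disk_algebra_B_cmult:
  assumes "f \<in> A"
  shows "(\<lambda>z. c * f z) \<in> A"
proof -
  obtain d where "(\<lambda>z. f z - d * on_disk (\<lambda>_. 1) z) \<in> J"
    using assms disk_algebra_B_decomposition by blast
  from vanishing_ideal_cmult[OF this, of c]
  have "(\<lambda>z. c * f z - (c * d) * on_disk (\<lambda>_. 1) z) \<in> J" by (simp add: algebra_simps)
  then show ?thesis unfolding disk_algebra_B_decomposition by blast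
qed

lemma disk_algebra_B_add:
  assumes "f \<in> A" "g \<in> A"
  shows "(\<lambda>z. f z + g z) \<in> A"
proof -
  obtain c d where "(\<lambda>z. f z - c * on_disk (\<lambda>_. 1) z) \<in> J" "(\<lambda>z. g z - d * on_disk (\<lambda>_. 1) z) \<in> J"
    using assms disk_algebra_B_decomposition by blast
  from vanishing_ideal_add[OF this]
  have "(\<lambda>z. (f z + g z) - (c + d) * on_disk (\<lambda>_. 1) z) \<in> J" by (simp add: algebra_simps)
  then show ?thesis unfolding disk_algebra_B_decomposition by blast
qed

lemma disk_algebra_B_mult:
  assumes "f \<in> A" "g \<in> A"
  shows "(\<lambda>z. f z * g z) \<in> A"
proof -
  obtain d where d: "(\<lambda>z. g z - d * on_disk (\<lambda>_. 1) z) \<in> J"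
    using assms disk_algebra_B_decomposition by blast
  have f: "f \<in> disk_algebra" using assms(1) disk_algebra_B_subset by blast
  have "(\<lambda>z. f z * (g z - d * on_disk (\<lambda>_. 1) z) + d * f z) \<in> A"
    using vanishing_ideal_mult[OF f d] in_vanishing_ideal_iff
    by (intro disk_algebra_B_add disk_algebra_B_cmult assms(1)) blast
  moreover have "f z * (g z - d * on_disk (\<lambda>_. 1) z) + d * f z = f z * g z" for z
  proof -
    have "f z * (g z - d * on_disk (\<lambda>_. 1) z) = f z * g z - d * (on_disk (\<lambda>_. 1) z * f z)"
      by (simp add: right_diff_distrib mult_ac)
    then show ?thesis using fun_cong[OF on_disk_1_mult[OF f], of z] by simp
  qed
  ultimately show ?thesis by simp
qed

text \<open>A nonconstant element of \<open>A\<close> minus its common value at the zeros is the nonzero function in the disk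
  algebra that \<open>zero_data_function\<close> asks for.\<close>

lemma nonvanishing_ideal_element:
  assumes "A \<noteq> disk_constants"
  obtains h where "h \<in> J" "\<And>z. z \<in> cball 0 1 - closure E \<Longrightarrow> h z \<noteq> 0"
proof -
  have const: "disk_constants = range (\<lambda>c z. c * on_disk (\<lambda>_. 1) z)"
    unfolding disk_constants_def by (rule arg_cong[where f = range]) (auto simp: on_disk_def fun_eq_iff)
  have "disk_constants \<subseteq> A" unfolding const by (intro image_subsetI disk_algebra_B_const)
  then obtain f where f: "f \<in> A" "f \<notin> disk_constants" using assms by blast
  obtain c where c: "\<And>k. k \<in> zero_index N \<Longrightarrow> f (a k) = c" using common_value[OF f(1)] by blast
  define g where "g = (\<lambda>z. f z - c * on_disk (\<lambda>_. 1) z)"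
  have g: "g \<in> J" unfolding g_def by (rule diff_common_value_in_ideal[OF f(1) c])
  then have gD: "g \<in> disk_algebra" by (simp add: vanishing_ideal_def)
  have g0: "g (a k) = 0" if "k \<in> zero_index N" for k using g that by (simp add: in_vanishing_ideal_iff)
  have "\<exists>\<beta>\<in>ball 0 1. g \<beta> \<noteq> 0"
  proof (rule ccontr)
    assume "\<not> (\<exists>\<beta>\<in>ball 0 1. g \<beta> \<noteq> 0)"
    then have "g z = 0" if "z \<in> cball 0 1" for z
      using continuous_constant_on_closure[of "ball 0 1" g 0] gD that by (auto simp: disk_algebra_def)
    then have "g z = 0" for z using gD by (cases "z \<in> cball 0 1") (auto simp: disk_algebra_def)
    then have "f = (\<lambda>z. c * on_disk (\<lambda>_. 1) z)" by (auto simp: g_def fun_eq_iff)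
    with f(2) show False unfolding const by blast
  qed
  then obtain \<beta> where "\<beta> \<in> ball 0 1" "g \<beta> \<noteq> 0" by blast
  from zero_data_function[OF zero_in_disk blaschke_condition gD g0 this]
  obtain h where "h \<in> disk_algebra" "\<And>k. k \<in> zero_index N \<Longrightarrow> vanishes_to_order (m k) h (a k)"
    "\<And>z. z \<in> cball 0 1 - closure E \<Longrightarrow> h z \<noteq> 0" by blast
  then show thesis by (intro that[of h]) (auto simp: vanishing_ideal_def)
qed

text \<open>If \<open>\<phi>\<close> is nonzero at some \<open>g \<in> J\<close>, then \<open>f \<mapsto> \<phi> (f g) / \<phi> g\<close> is a character of the disk algebra that
  extends \<open>\<phi>\<close>. If \<open>\<phi>\<close> vanishes on \<open>J\<close>, it is evaluation at any zero; there is one, since otherwise \<open>J\<close>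
  would contain the unit.\<close>

lemma character_is_eval:
  assumes \<phi>: "\<phi> \<in> characters A"
  shows "\<exists>l\<in>cball 0 1. \<phi> = point_eval A l"
proof -
  let ?u = "on_disk (\<lambda>_. 1)"
  have ext: "\<phi> \<in> extensional A" using \<phi> by (simp add: characters_def)
  have u: "?u \<in> A" using disk_algebra_B_const[of 1] by simp
  have \<phi>u: "\<phi> ?u = 1"
    by (rule character_unit[OF \<phi> u]) (use on_disk_1_mult disk_algebra_B_subset in blast)
  have JA: "J \<subseteq> A" by (auto simp: in_vanishing_ideal_iff)
  have "\<exists>l\<in>cball 0 1. \<forall>f\<in>A. \<phi> f = f l"
  proof (cases "\<exists>g\<in>J. \<phi> g \<noteq> 0")
    case True
    then obtain g where g: "g \<in> J" "\<phi> g \<noteq> 0" by blast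
    have fg: "(\<lambda>z. f z * g z) \<in> A" if "f \<in> disk_algebra" for f
      using vanishing_ideal_mult[OF that g(1)] JA by blast
    have gA: "g \<in> A" using g(1) JA by blast
    define \<psi> where "\<psi> = (\<lambda>f\<in>disk_algebra. \<phi> (\<lambda>z. f z * g z) / \<phi> g)"
    have "\<psi> \<in> characters disk_algebra"
      unfolding characters_def mem_Collect_eq
    proof (intro conjI ballI allI)
      show "\<psi> \<in> extensional disk_algebra" by (simp add: \<psi>_def)
      fix f1 f2 assume f: "f1 \<in> disk_algebra" "f2 \<in> disk_algebra"
      show "\<psi> (\<lambda>x. f1 x + f2 x) = \<psi> f1 + \<psi> f2"
        using character_add[OF \<phi> fg[OF f(1)] fg[OF f(2)]] f disk_algebra_add[OF f]
        by (simp add: \<psi>_def distrib_right add_divide_distrib)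
      have "\<phi> (\<lambda>x. f1 x * f2 x * g x) * \<phi> g = \<phi> (\<lambda>x. f1 x * f2 x * g x * g x)"
        using character_mult[OF \<phi> fg[OF disk_algebra_mult[OF f]] gA] by simp
      also have "\<dots> = \<phi> (\<lambda>x. f1 x * g x) * \<phi> (\<lambda>x. f2 x * g x)"
        using character_mult[OF \<phi> fg[OF f(1)] fg[OF f(2)]] by (simp add: mult_ac)
      finally show "\<psi> (\<lambda>x. f1 x * f2 x) = \<psi> f1 * \<psi> f2"
        using f disk_algebra_mult[OF f] g(2) by (simp add: \<psi>_def field_simps)
    next
      fix c f assume f: "f \<in> disk_algebra"
      show "\<psi> (\<lambda>x. c * f x) = c * \<psi> f"
        using character_cmult[OF \<phi> fg[OF f], of c] f disk_algebra_cmult[OF f, of c]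
        by (simp add: \<psi>_def mult.assoc)
    next
      have "\<psi> ?u = 1"
        using on_disk_1_mult[of g] gA disk_algebra_B_subset on_disk_1_in_disk_algebra g(2)
        by (simp add: \<psi>_def subset_iff)
      then show "\<exists>f\<in>disk_algebra. \<psi> f \<noteq> 0"
        using on_disk_1_in_disk_algebra by force
    qed
    then obtain l where l: "l \<in> cball 0 1" "\<And>f. f \<in> disk_algebra \<Longrightarrow> \<psi> f = f l"
      using disk_algebra_character_is_eval by blast
    have "\<phi> f = f l" if f: "f \<in> A" for f
    proof -
      have fD: "f \<in> disk_algebra" using f disk_algebra_B_subset by blast
      have "\<psi> f = \<phi> f"
        using character_mult[OF \<phi> f gA] fD g(2) by (simp add: \<psi>_def)
      then show ?thesis using l(2)[OF fD] by simp
    qed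
    then show ?thesis using l(1) by blast
  next
    case False
    show ?thesis
    proof (cases "zero_index N = {}")
      case True
      then have "?u \<in> J" using u by (simp add: in_vanishing_ideal_iff)
      with False \<phi>u show ?thesis by force
    next
      case False': False
      then obtain k where k: "k \<in> zero_index N" by blast
      have "\<phi> f = f (a k)" if f: "f \<in> A" for f
      proof -
        define c where "c = f (a k)"
        have "f (a j) = c" if "j \<in> zero_index N" for j
          using f k that unfolding c_def disk_algebra_B_def by blast
        then have J: "(\<lambda>z. f z - c * ?u z) \<in> J" by (rule diff_common_value_in_ideal[OF f])
        then have "\<phi> (\<lambda>z. f z - c * ?u z) = 0" using False by blast
        then show ?thesis
          using character_add[OF \<phi> subsetD[OF JA J] disk_algebra_B_const[of c]]
            character_cmult[OF \<phi> u, of c] \<phi>u by (simp add: c_def)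
      qed
      moreover have "a k \<in> cball 0 1" using zero_in_disk[OF k] by simp
      ultimately show ?thesis by blast
    qed
  qed
  then obtain l where "l \<in> cball 0 1" "\<And>f. f \<in> A \<Longrightarrow> \<phi> f = f l" by blast
  moreover from this have "\<phi> = point_eval A l"
    using ext by (auto simp: point_eval_def extensional_def fun_eq_iff)
  ultimately show ?thesis by blast
qed

lemma eval_is_character:
  assumes "l \<in> cball 0 1"
  shows "point_eval A l \<in> characters A"
proof -
  note closed = disk_algebra_B_add disk_algebra_B_cmult disk_algebra_B_mult
  have u: "on_disk (\<lambda>_. 1) \<in> A" using disk_algebra_B_const[of 1] by simp
  have "point_eval A l (on_disk (\<lambda>_. 1)) \<noteq> 0" using u assms by (simp add: point_eval_def on_disk_def)
  with u have "\<exists>f\<in>A. point_eval A l f \<noteq> 0" by blast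
  then show ?thesis
    using closed by (auto simp: characters_def point_eval_def)
qed

lemma closed_disk_rel_iff:
  "(z, w) \<in> closed_disk_rel E \<longleftrightarrow>
     z \<in> cball 0 1 \<and> w \<in> cball 0 1 \<and> (z = w \<or> z \<in> closure E \<and> w \<in> closure E)"
proof -
  have "E \<subseteq> cball 0 1" using zero_in_disk by force
  then have "top_of_set (cball 0 1) closure_of E = cball 0 1 \<inter> closure E"
    by (simp add: closure_of_subtopology Int_absorb1)
  then show ?thesis by (auto simp: closed_disk_rel_def)
qed

text \<open>With \<open>h \<in> J\<close> nonzero off the closure of \<open>E\<close>, the function \<open>(x - w) h x\<close> separates \<open>w\<close> from every other point
  outside that closure. Conversely, elements of \<open>A\<close> are constant on \<open>E\<close>, hence on its closure.\<close>

lemma point_eval_eq_iff: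
  assumes nc: "A \<noteq> disk_constants" and z: "z \<in> cball 0 1" and w: "w \<in> cball 0 1"
  shows "point_eval A z = point_eval A w \<longleftrightarrow> (z, w) \<in> closed_disk_rel E"
proof
  assume eq: "point_eval A z = point_eval A w"
  have eqA: "f z = f w" if "f \<in> A" for f
    using fun_cong[OF eq, of f] that by (simp add: point_eval_def)
  obtain h where h: "h \<in> J" "\<And>z. z \<in> cball 0 1 - closure E \<Longrightarrow> h z \<noteq> 0"
    using nonvanishing_ideal_element[OF nc] by blast
  have sep: "x = y" if xy: "x \<in> cball 0 1" "y \<in> cball 0 1" "x \<notin> closure E" "\<And>f. f \<in> A \<Longrightarrow> f x = f y" for x y
  proof -
    define d where "d = (\<lambda>z. on_disk (\<lambda>z. z - y) z * h z)"
    have "on_disk (\<lambda>z. z - y) \<in> disk_algebra"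
      by (rule on_disk_in_disk_algebra) (auto intro!: holomorphic_intros continuous_intros)
    then have "d \<in> A"
      unfolding d_def using vanishing_ideal_mult[OF _ h(1)] in_vanishing_ideal_iff by blast
    then have "d x = d y" by (rule xy(4))
    then show ?thesis using h(2)[of x] xy(1-3) by (simp add: d_def on_disk_def)
  qed
  have "z = w \<or> z \<in> closure E \<and> w \<in> closure E"
    using sep[OF z w _ eqA] sep[OF w z _ eqA[symmetric]] by blast
  then show "(z, w) \<in> closed_disk_rel E"
    using z w by (simp add: closed_disk_rel_iff)
next
  assume "(z, w) \<in> closed_disk_rel E"
  then consider "z = w" | "z \<in> closure E" "w \<in> closure E" by (auto simp: closed_disk_rel_iff)
  then show "point_eval A z = point_eval A w"
  proof cases
    case 2
    have "f z = f w" if f: "f \<in> A" for f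
    proof -
      obtain c where c: "\<And>k. k \<in> zero_index N \<Longrightarrow> f (a k) = c" using common_value[OF f] by blast
      have "E \<subseteq> cball 0 1" using zero_in_disk by force
      then have "closure E \<subseteq> cball 0 1" by (rule closure_minimal) simp
      moreover have "continuous_on (cball 0 1) f"
        using subsetD[OF disk_algebra_B_subset f] by (simp add: disk_algebra_def)
      ultimately have "continuous_on (closure E) f" using continuous_on_subset by blast
      then show ?thesis using continuous_constant_on_closure[of E f c] c 2 by auto
    qed
    then show ?thesis by (simp add: point_eval_def restrict_def fun_eq_iff)
  qed simp
qed

lemma continuous_map_point_eval:
  "continuous_map (top_of_set (cball 0 1)) (maximal_ideal_space A) (point_eval A)"
proof -
  have "continuous_map (top_of_set (cball 0 1)) euclidean (\<lambda>z. point_eval A z f)" if "f \<in> A" for f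
    using subsetD[OF disk_algebra_B_subset that] that by (simp add: point_eval_def disk_algebra_def)
  then have "continuous_map (top_of_set (cball 0 1)) (product_topology (\<lambda>_. euclidean) A) (point_eval A)"
    by (auto simp: continuous_map_componentwise point_eval_def)
  then show ?thesis
    using eval_is_character by (auto simp: maximal_ideal_space_def continuous_map_in_subtopology)
qed

lemma point_eval_image: "point_eval A ` cball 0 1 = characters A"
  using eval_is_character character_is_eval by blast

text \<open>A continuous surjection from a compact space onto a Hausdorff space is closed, hence a quotient map.\<close>

lemma quotient_map_point_eval:
  "quotient_map (top_of_set (cball 0 1)) (maximal_ideal_space A) (point_eval A)"
proof (rule Abstract_Topology.continuous_closed_imp_quotient_map)
  have "Hausdorff_space (maximal_ideal_space A)"
    unfolding maximal_ideal_space_def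
    by (intro Hausdorff_space_subtopology) (simp add: Hausdorff_space_product_topology)
  moreover have "compact_space (top_of_set (cball (0::complex) 1))"
    by (simp add: compact_space_subtopology)
  ultimately show "closed_map (top_of_set (cball 0 1)) (maximal_ideal_space A) (point_eval A)"
    by (rule T1_Spaces.continuous_imp_closed_map[OF continuous_map_point_eval, rotated])
qed (auto simp: continuous_map_point_eval point_eval_image)

text \<open>Evaluation is a quotient map and its fibres are the classes of the relation, so the induced map on
  the quotient is an injective quotient map.\<close>

lemma homeomorphic_quotient:
  assumes nc: "A \<noteq> disk_constants"
  shows "\<exists>h. homeomorphic_map
           (quotient_topology (top_of_set (cball 0 1)) (closed_disk_rel E)) (maximal_ideal_space A) h \<and>
         (\<forall>l\<in>cball 0 1. h (closed_disk_rel E `` {l}) = point_eval A l)"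
proof -
  let ?R = "closed_disk_rel E"
  let ?X = "top_of_set (cball (0::complex) 1)"
  have R: "equiv (topspace ?X) ?R" using equiv_closed_disk_rel by simp
  define h where "h = (\<lambda>C. point_eval A (SOME z. z \<in> C))"
  have h: "h (?R `` {l}) = point_eval A l" if "l \<in> cball 0 1" for l
  proof -
    have "l \<in> ?R `` {l}" using that by (simp add: closed_disk_rel_iff)
    then have "(SOME z. z \<in> ?R `` {l}) \<in> ?R `` {l}" by (rule someI)
    then have "(l, SOME z. z \<in> ?R `` {l}) \<in> ?R" by simp
    then show ?thesis
      unfolding h_def using point_eval_eq_iff[OF nc that] closed_disk_rel_iff by metis
  qed
  note q = quotient_map_quotient_topology[OF R]
  have "quotient_map ?X (maximal_ideal_space A) (h \<circ> (\<lambda>x. ?R `` {x}))"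
    by (rule quotient_map_eq[OF quotient_map_point_eval]) (simp add: h)
  then have "quotient_map (quotient_topology ?X ?R) (maximal_ideal_space A) h"
    using quotient_map_compose_eq[OF q] by blast
  moreover have "inj_on h (topspace (quotient_topology ?X ?R))"
  proof (rule inj_onI)
    fix C D assume CD: "C \<in> topspace (quotient_topology ?X ?R)" "D \<in> topspace (quotient_topology ?X ?R)"
      and eq: "h C = h D"
    have "topspace (quotient_topology ?X ?R) = (\<lambda>x. ?R `` {x}) ` cball 0 1"
      using quotient_imp_surjective_map[OF q] by simp
    then obtain z w where zw: "z \<in> cball 0 1" "w \<in> cball 0 1" "C = ?R `` {z}" "D = ?R `` {w}"
      using CD by auto
    then have "point_eval A z = point_eval A w" using eq h by simp
    then show "C = D"
      using point_eval_eq_iff[OF nc zw(1,2)] equiv_class_eq[OF equiv_closed_disk_rel] zw(3,4) by blast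
  qed
  ultimately have "homeomorphic_map (quotient_topology ?X ?R) (maximal_ideal_space A) h"
    by (simp add: homeomorphic_map_def)
  then show ?thesis using h by blast
qed

end

theorem theorem1p3:
  fixes B :: "complex \<Rightarrow> complex" and N :: enat and a :: "nat \<Rightarrow> complex" and m :: "nat \<Rightarrow> nat"
  assumes "is_blaschke_product B N a m"
    and "disk_algebra_B N a m \<noteq> disk_constants"
  shows "topspace (maximal_ideal_space (disk_algebra_B N a m)) =
           point_eval (disk_algebra_B N a m) ` cball 0 1 \<and>
         (\<exists>h. homeomorphic_map
                (quotient_topology (top_of_set (cball 0 1)) (closed_disk_rel (a ` zero_index N)))
                (maximal_ideal_space (disk_algebra_B N a m)) h \<and>
              (\<forall>l\<in>cball 0 1. h (closed_disk_rel (a ` zero_index N) `` {l}) =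
                             point_eval (disk_algebra_B N a m) l))"
proof -
  interpret blaschke_zeros N a m
    by unfold_locales (use assms(1) in \<open>auto simp: is_blaschke_product_def\<close>)
  show ?thesis
    using point_eval_image homeomorphic_quotient[OF assms(2)] by simp
qed

end
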